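(* Let $1<p_0<\infty$ and let $f$ and $g$ be two positive measurable functions on $\mathbb R^n$ such that, for every $w\in A_{p_0}$, $$\|g\|_{L^{p_0,\infty}(w)}\le \varphi(\|w\|_{A_{p_0}})\,\|f\|_{L^{p_0}(w)},$$ where $\varphi$ is a locally bounded function. Then, for every $0\le\alpha<p_0-1$, every $0<\mu<1$, every positive locally integrable function $u$ on $\mathbb R^n$ and every $y>0$, $$\lambda^u_g(y)\le C\Big(\lambda^u_{Mf}(y)+\frac1{y^{p_0-\alpha}}\int_{\mathbb R^n} f^{p_0-\alpha}(x)\,M_\mu(u\chi_{\{g>y\}})(x)\,dx\Big),$$ where the constant $C$ is independent of $f$, $g$, $u$ and $y$ (it may depend on $n,p_0,\alpha,\mu,\varphi$).
   Context: $Mf(x)=\sup_{x\in Q}\frac1{|Q|}\int_Q|f|$ is the Hardy–Littlewood maximal operator (supremum over cubes $Q\subset\mathbb R^n$ containing $x$). For $0<\mu<1$, $M_\mu f(x)=\big(M(|f|^{1/\mu})(x)\big)^\mu$. For a function $g$ and a positive locally integrable $u$, $\lambda_g^u(y)=u(\{x: |g(x)|>y\})=\int_{\{|g|>y\}}u\,dx$. $\|g\|_{L^{p,\infty}(w)}=\sup_{y>0}y\,\lambda_g^w(y)^{1/p}$. For $1<p<\infty$, $A_p$ is the Muckenhoupt class of weights with $\|w\|_{A_p}=\sup_Q\big(\frac1{|Q|}\int_Qw\big)\big(\frac1{|Q|}\int_Qw^{-1/(p-1)}\big)^{p-1}<\infty$. A function $\varphi$ on $(0,\infty)$ is locally bounded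 if $\sup_{0<t<K}\varphi(t)<\infty$ for every $K>0$. *)

theory Defs
  imports "HOL-Analysis.Analysis"
begin

text \<open>
  Quantities that may be infinite (averages, maximal functions, distribution functions,
  norms) take values in the type \<^typ>\<open>ennreal\<close>, with the convention that zero times infinity
  is zero. Measurability and integrals are with respect to Lebesgue measure on
  \<^typ>\<open>real ^ 'n\<close>.
\<close>

text \<open>Real power on the extended half-line; meaningful only for exponents \<open>a > 0\<close>.\<close>

definition epowr :: "ennreal \<Rightarrow> real \<Rightarrow> ennreal" where
  "epowr x a = (if x = \<infinity> then \<infinity> else ennreal (enn2real x powr a))"

text \<open>Closed cubes with sides parallel to the axes.\<close>

definition cubes :: "(real ^ 'n) set set" where
  "cubes = {cbox a (\<chi> i. a $ i + l) | a l. 0 < l}"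

definition avg :: "(real ^ 'n) set \<Rightarrow> (real ^ 'n \<Rightarrow> ennreal) \<Rightarrow> ennreal" where
  "avg Q h = (\<integral>\<^sup>+x\<in>Q. h x \<partial>lebesgue) / emeasure lebesgue Q"

definition maximal :: "(real ^ 'n \<Rightarrow> real) \<Rightarrow> real ^ 'n \<Rightarrow> ennreal" where
  "maximal f x = (SUP Q\<in>{Q \<in> cubes. x \<in> Q}. avg Q (\<lambda>t. ennreal \<bar>f t\<bar>))"

definition maximal_mu :: "real \<Rightarrow> (real ^ 'n \<Rightarrow> real) \<Rightarrow> real ^ 'n \<Rightarrow> ennreal" where
  "maximal_mu \<mu> f x = epowr (maximal (\<lambda>t. \<bar>f t\<bar> powr (1 / \<mu>)) x) \<mu>"

definition locally_integrable :: "(real ^ 'n \<Rightarrow> real) \<Rightarrow> bool" where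
  "locally_integrable u \<longleftrightarrow>
     u \<in> borel_measurable lebesgue \<and> (\<forall>K. compact K \<longrightarrow> set_integrable lebesgue K u)"

text \<open>
  The argument \<open>G\<close> stands for the modulus of the function whose distribution is taken. It is
  extended-valued so that it can also be a maximal function.
\<close>

definition dist_fn :: "(real ^ 'n \<Rightarrow> real) \<Rightarrow> (real ^ 'n \<Rightarrow> ennreal) \<Rightarrow> real \<Rightarrow> ennreal" where
  "dist_fn u G y = (\<integral>\<^sup>+x\<in>{x. ennreal y < G x}. ennreal (u x) \<partial>lebesgue)"

definition Lp_norm :: "real \<Rightarrow> (real ^ 'n \<Rightarrow> real) \<Rightarrow> (real ^ 'n \<Rightarrow> real) \<Rightarrow> ennreal" where
  "Lp_norm p w f = epowr (\<integral>\<^sup>+x. ennreal (\<bar>f x\<bar> powr p * w x) \<partial>lebesgue) (1 / p)"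

definition weak_Lp_norm :: "real \<Rightarrow> (real ^ 'n \<Rightarrow> real) \<Rightarrow> (real ^ 'n \<Rightarrow> real) \<Rightarrow> ennreal" where
  "weak_Lp_norm p w g =
     (SUP y\<in>{0<..}. ennreal y * epowr (dist_fn w (\<lambda>x. ennreal \<bar>g x\<bar>) y) (1 / p))"

definition weight :: "(real ^ 'n \<Rightarrow> real) \<Rightarrow> bool" where
  "weight w \<longleftrightarrow> locally_integrable w \<and> (\<forall>x. 0 \<le> w x) \<and> (AE x in lebesgue. 0 < w x)"

definition Ap_const :: "real \<Rightarrow> (real ^ 'n \<Rightarrow> real) \<Rightarrow> ennreal" where
  "Ap_const p w =
     (SUP Q\<in>cubes. avg Q (\<lambda>x. ennreal (w x)) *
        epowr (avg Q (\<lambda>x. ennreal (w x powr (- 1 / (p - 1))))) (p - 1))"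

definition Ap :: "real \<Rightarrow> (real ^ 'n \<Rightarrow> real) set" where
  "Ap p = {w. weight w \<and> Ap_const p w < \<infinity>}"

text \<open>Functions on the open half-line are total functions whose values outside it are ignored.\<close>

definition locally_bounded :: "(real \<Rightarrow> real) \<Rightarrow> bool" where
  "locally_bounded \<phi> \<longleftrightarrow> (\<forall>K>0. bdd_above (\<phi> ` {0<..<K}))"

end

theory Submission
  imports Defs
begin
text \<open>
  Put \<open>h = (u \<chi>\<^bsub>{g > y}\<^esub>)\<^bsup>1/\<mu>\<^esup>\<close>. For \<open>0 \<le> \<gamma> < 1\<close> the powers \<open>(Mf)\<^sup>\<gamma>\<close> and \<open>(Mh)\<^sup>\<gamma>\<close> are
  \<open>A\<^sub>1\<close> weights with constants depending only on \<open>n\<close> and \<open>\<gamma>\<close> (Kolmogorov's inequality), so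
  \<open>w = (Mf)\<^bsup>-\<alpha>\<^esup> (Mh)\<^sup>\<mu>\<close> lies in \<open>A\<^bsub>p\<^sub>0\<^esub>\<close> with a constant independent of the functions. On
  \<open>{g > y, Mf \<le> y}\<close> one has \<open>u \<le> y\<^sup>\<alpha> w\<close>, so the weak type hypothesis for \<open>w\<close> applies, and
  \<open>f \<le> Mf\<close> a.e. turns \<open>f\<^bsup>p\<^sub>0\<^esup> w\<close> into \<open>f\<^bsup>p\<^sub>0 - \<alpha>\<^esup> M\<^sub>\<mu>(u \<chi>\<^bsub>{g > y}\<^esub>)\<close>. When \<open>Mf\<close> or \<open>Mh\<close> is
  identically infinite, or \<open>f\<close> or \<open>h\<close> vanishes a.e., the inequality is immediate.
\<close>

section \<open>Cubes, averages and semicontinuity of the maximal function\<close>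

definition cube :: "real ^ 'n \<Rightarrow> real \<Rightarrow> (real ^ 'n) set" where
  "cube a l = cbox a (\<chi> i. a $ i + l)"

lemma mem_cube: "x \<in> cube a l \<longleftrightarrow> (\<forall>i. a $ i \<le> x $ i \<and> x $ i \<le> a $ i + l)"
  by (simp add: cube_def mem_box_cart)

lemma cube_sets [measurable, simp]: "cube a l \<in> sets lebesgue"
  unfolding cube_def by simp

lemma emeasure_cube:
  assumes "0 \<le> l"
  shows "emeasure lebesgue (cube (a :: real ^ 'n) l) = ennreal (l ^ CARD('n))"
proof -
  have "cbox a (\<chi> i. a $ i + l) \<noteq> {}"
    using assms by (auto simp: interval_ne_empty_cart)
  then have "measure lebesgue (cbox a (\<chi> i. a $ i + l)) = l ^ CARD('n)"
    by (simp add: content_cbox_cart)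
  then show ?thesis
    unfolding cube_def using emeasure_eq_measure2[OF lmeasurable_cbox] by metis
qed

lemma cube_not_AE:
  assumes "0 < l" "AE x in lebesgue. x \<notin> cube (a :: real ^ 'n) l"
  shows False
proof -
  have "emeasure lebesgue (cube a l) = 0"
    using assms(2) by (subst (asm) AE_iff_measurable[of "cube a l"]) auto
  then show False using assms(1) emeasure_cube[of l a] by simp
qed

lemma cube_subset_cubeI:
  assumes "\<And>i. b $ i \<le> a $ i" "\<And>i. a $ i + l \<le> b $ i + m"
  shows "cube a l \<subseteq> cube b m"
  using assms unfolding subset_iff mem_cube by (meson order_trans)

lemma cubes_eq: "cubes = {cube a l | a l. 0 < l}"
  by (simp add: cubes_def cube_def)

text \<open>The measure of a cube is neither 0 nor infinite, so the denominator can be cleared.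
  Later estimates then compare integrals with products and avoid division in
  \<open>ennreal\<close>.\<close>

lemma avg_cube_iff:
  assumes "0 < l"
  shows "s < avg (cube (a :: real ^ 'n) l) h \<longleftrightarrow>
    s * ennreal (l ^ CARD('n)) < (\<integral>\<^sup>+x\<in>cube a l. h x \<partial>lebesgue)"
    and "avg (cube a l) h \<le> s \<longleftrightarrow> (\<integral>\<^sup>+x\<in>cube a l. h x \<partial>lebesgue) \<le> s * ennreal (l ^ CARD('n))"
proof -
  have pos: "ennreal (l ^ CARD('n)) \<noteq> 0"
    using assms by simp
  show "avg (cube a l) h \<le> s \<longleftrightarrow> (\<integral>\<^sup>+x\<in>cube a l. h x \<partial>lebesgue) \<le> s * ennreal (l ^ CARD('n))" for s
  proof
    assume "avg (cube a l) h \<le> s"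
    then have "avg (cube a l) h * ennreal (l ^ CARD('n)) \<le> s * ennreal (l ^ CARD('n))"
      by (rule mult_right_mono) simp
    then show "(\<integral>\<^sup>+x\<in>cube a l. h x \<partial>lebesgue) \<le> s * ennreal (l ^ CARD('n))"
      using pos unfolding avg_def emeasure_cube[OF less_imp_le[OF assms]]
      by (simp add: ennreal_divide_times)
  next
    assume "(\<integral>\<^sup>+x\<in>cube a l. h x \<partial>lebesgue) \<le> s * ennreal (l ^ CARD('n))"
    then have "avg (cube a l) h \<le> s * ennreal (l ^ CARD('n)) / ennreal (l ^ CARD('n))"
      unfolding avg_def emeasure_cube[OF less_imp_le[OF assms]] by (rule divide_right_mono_ennreal)
    then show "avg (cube a l) h \<le> s"
      using pos by (simp add: ennreal_mult_divide_eq)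
  qed
  then show "s < avg (cube (a :: real ^ 'n) l) h \<longleftrightarrow>
    s * ennreal (l ^ CARD('n)) < (\<integral>\<^sup>+x\<in>cube a l. h x \<partial>lebesgue)"
    by (simp add: not_le[symmetric])
qed

lemma less_maximal_iff:
  "s < maximal f (x :: real ^ 'n) \<longleftrightarrow> (\<exists>a l. 0 < l \<and> x \<in> cube a l \<and>
     s * ennreal (l ^ CARD('n)) < (\<integral>\<^sup>+t\<in>cube a l. ennreal \<bar>f t\<bar> \<partial>lebesgue))"
  unfolding maximal_def cubes_eq less_SUP_iff by (force simp: avg_cube_iff)

lemma integral_cube_le_maximal:
  assumes "0 < l" "x \<in> cube (a :: real ^ 'n) l"
  shows "(\<integral>\<^sup>+t\<in>cube a l. ennreal \<bar>f t\<bar> \<partial>lebesgue) \<le> maximal f x * ennreal (l ^ CARD('n))"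
proof -
  have "avg (cube a l) (\<lambda>t. ennreal \<bar>f t\<bar>) \<le> maximal f x"
    unfolding maximal_def using assms by (intro SUP_upper) (auto simp: cubes_eq)
  then show ?thesis using assms by (simp add: avg_cube_iff)
qed

lemma cube_mono_integral:
  assumes "cube a l \<subseteq> cube b m"
  shows "(\<integral>\<^sup>+t\<in>cube a l. h t \<partial>lebesgue) \<le> (\<integral>\<^sup>+t\<in>cube b m. h t \<partial>lebesgue)"
  using assms by (intro nn_integral_mono) (auto split: split_indicator)

text \<open>A strict lower bound for the average over one cube survives a slight enlargement of that
  cube, and the enlarged cube contains a whole ball around \<open>x\<close>. Measurability of
  \<open>maximal f\<close> follows.\<close>

lemma open_maximal_greater: "open {x :: real ^ 'n. s < maximal f x}"
proof (subst open_contains_ball, safe)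
  fix x :: "real ^ 'n" assume "s < maximal f x"
  then obtain a l where al: "0 < l" "x \<in> cube a l"
    "s * ennreal (l ^ CARD('n)) < (\<integral>\<^sup>+t\<in>cube a l. ennreal \<bar>f t\<bar> \<partial>lebesgue)"
    by (auto simp: less_maximal_iff)
  have "s \<noteq> top" using \<open>s < maximal f x\<close> by auto
  then obtain r where r: "s = ennreal r" "0 \<le> r" by (cases s) auto
  \<comment> \<open>Growing the cube by \<open>e\<close> on every side changes its volume
    continuously, so some positive \<open>e\<close> keeps the strict inequality.\<close>
  have "((\<lambda>e. ennreal (r * (l + 2 * e) ^ CARD('n))) \<longlongrightarrow> ennreal (r * (l + 2 * 0) ^ CARD('n))) (at_right 0)"
    by (intro tendsto_intros)
  then have "eventually (\<lambda>e. ennreal (r * (l + 2 * e) ^ CARD('n)) < (\<integral>\<^sup>+t\<in>cube a l. ennreal \<bar>f t\<bar> \<partial>lebesgue)) (at_right 0)"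
    by (rule order_tendstoD) (use al r in \<open>simp add: ennreal_mult\<close>)
  from eventually_happens'[OF trivial_limit_at_right_real eventually_conj[OF eventually_at_right_less this]]
  obtain e where e: "0 < e" "ennreal (r * (l + 2 * e) ^ CARD('n)) < (\<integral>\<^sup>+t\<in>cube a l. ennreal \<bar>f t\<bar> \<partial>lebesgue)"
    by blast
  define b :: "real ^ 'n" where "b = (\<chi> i. a $ i - e)"
  have sub: "cube a l \<subseteq> cube b (l + 2 * e)"
    using e(1) unfolding b_def by (intro cube_subset_cubeI) auto
  have "s < maximal f y" if "y \<in> ball x e" for y
  proof -
    have "b $ i \<le> y $ i \<and> y $ i \<le> b $ i + (l + 2 * e)" for i
    proof -
      have "\<bar>x $ i - y $ i\<bar> < e"
        using that component_le_norm_cart[of "x - y" i] by (auto simp: dist_norm)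
      moreover have "a $ i \<le> x $ i \<and> x $ i \<le> a $ i + l" using al(2) by (auto simp: mem_cube)
      ultimately show ?thesis unfolding b_def by (simp add: abs_less_iff)
    qed
    then have "y \<in> cube b (l + 2 * e)" by (simp add: mem_cube)
    moreover have "s * ennreal ((l + 2 * e) ^ CARD('n)) < (\<integral>\<^sup>+t\<in>cube b (l + 2 * e). ennreal \<bar>f t\<bar> \<partial>lebesgue)"
      using e(2) cube_mono_integral[OF sub, of "\<lambda>t. ennreal \<bar>f t\<bar>"] e(1) al(1) r by (simp add: ennreal_mult)
    ultimately show ?thesis using e(1) al(1) unfolding less_maximal_iff
      by (intro exI[of _ b] exI[of _ "l + 2 * e"]) auto
  qed
  then show "\<exists>e>0. ball x e \<subseteq> {x. s < maximal f x}" using e(1) by blast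
qed

lemma borel_measurable_maximal [measurable]: "maximal f \<in> borel_measurable lebesgue"
  by (rule borel_measurableI_greater) (simp add: open_maximal_greater borel_open)

section \<open>Countable covers and the local weak (1,1) estimate\<close>

text \<open>Each point of \<open>A\<close> is counted at least once in the sum of the indicators of
  the cover. Writing the sum as an integral over \<open>count_space I\<close> lets it be exchanged
  with the integral over \<open>M\<close>.\<close>

lemma nn_integral_le_countable_cover:
  assumes "countable I" "A \<subseteq> (\<Union>i\<in>I. X i)" "h \<in> borel_measurable M" "\<And>i. i \<in> I \<Longrightarrow> X i \<in> sets M"
  shows "(\<integral>\<^sup>+x\<in>A. h x \<partial>M) \<le> (\<integral>\<^sup>+i. (\<integral>\<^sup>+x\<in>X i. h x \<partial>M) \<partial>count_space I)"
proof -
  have "(\<integral>\<^sup>+x\<in>A. h x \<partial>M) \<le> (\<integral>\<^sup>+x. (\<integral>\<^sup>+i. h x * indicator (X i) x \<partial>count_space I) \<partial>M)"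
  proof (rule nn_integral_mono)
    fix x
    show "h x * indicator A x \<le> (\<integral>\<^sup>+i. h x * indicator (X i) x \<partial>count_space I)"
    proof (cases "x \<in> A")
      case True
      then obtain i where "i \<in> I" "x \<in> X i" using assms(2) by auto
      then show ?thesis
        using True nn_integral_ge_point[of i I "\<lambda>i. h x * indicator (X i) x"] by simp
    qed simp
  qed
  also have "\<dots> = (\<integral>\<^sup>+i. (\<integral>\<^sup>+x\<in>X i. h x \<partial>M) \<partial>count_space I)"
    using assms by (intro nn_integral_count_space_nn_integral) auto
  finally show ?thesis .
qed

lemma nn_integral_disjoint_family_le:
  assumes "countable I" "disjoint_family_on X I" "h \<in> borel_measurable M"
    "\<And>i. i \<in> I \<Longrightarrow> X i \<in> sets M" "\<And>i. i \<in> I \<Longrightarrow> X i \<subseteq> A"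
  shows "(\<integral>\<^sup>+i. (\<integral>\<^sup>+x\<in>X i. h x \<partial>M) \<partial>count_space I) \<le> (\<integral>\<^sup>+x\<in>A. h x \<partial>M)"
proof -
  have U: "(\<Union>i\<in>I. X i) \<in> sets M" using assms by auto
  have "(\<integral>\<^sup>+i. (\<integral>\<^sup>+x\<in>X i. h x \<partial>M) \<partial>count_space I) = (\<integral>\<^sup>+i. emeasure (density M h) (X i) \<partial>count_space I)"
    using assms by (intro nn_integral_cong) (simp add: emeasure_density)
  also have "\<dots> = emeasure (density M h) (\<Union>i\<in>I. X i)"
    using assms by (intro emeasure_UN_countable[symmetric]) auto
  also have "\<dots> = (\<integral>\<^sup>+x\<in>(\<Union>i\<in>I. X i). h x \<partial>M)"
    using assms U by (simp add: emeasure_density)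
  also have "\<dots> \<le> (\<integral>\<^sup>+x\<in>A. h x \<partial>M)"
    using assms(5) by (intro nn_integral_mono) (auto split: split_indicator)
  finally show ?thesis .
qed

text \<open>The covering argument runs with balls. This inclusion and the next one pass between
  balls and cubes at the price of dimensional factors; the radius comes from bounding the norm by
  the sum of the coordinates.\<close>

lemma cube_subset_cball:
  fixes b :: "real ^ 'n" and r :: real
  assumes "0 \<le> r"
  shows "cube b r \<subseteq> cball (\<chi> i. b $ i + r / 2) (CARD('n) * r)"
proof
  fix x assume x: "x \<in> cube b r"
  let ?c = "(\<chi> i. b $ i + r / 2) :: real ^ 'n"
  have "norm (x - ?c) \<le> (\<Sum>i\<in>UNIV. \<bar>(x - ?c) $ i\<bar>)" by (rule norm_le_l1_cart)
  also have "\<dots> \<le> (\<Sum>i\<in>(UNIV::'n set). r)"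
  proof (rule sum_mono)
    fix i :: 'n
    have "b $ i \<le> x $ i \<and> x $ i \<le> b $ i + r" using x by (auto simp: mem_cube)
    then show "\<bar>(x - ?c) $ i\<bar> \<le> r" using assms by (simp add: abs_le_iff field_simps)
  qed
  finally show "x \<in> cball ?c (CARD('n) * r)"
    by (simp add: dist_norm norm_minus_commute)
qed

lemma cball_subset_cube: "cball c R \<subseteq> cube (\<chi> i. c $ i - R) (2 * R)"
proof
  fix x assume x: "x \<in> cball c R"
  have "c $ i - R \<le> x $ i \<and> x $ i \<le> c $ i - R + 2 * R" for i
  proof -
    have "\<bar>c $ i - x $ i\<bar> \<le> R"
      using x component_le_norm_cart[of "c - x" i] by (auto simp: dist_norm)
    then show ?thesis by linarith
  qed
  then show "x \<in> cube (\<chi> i. c $ i - R) (2 * R)" by (simp add: mem_cube)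
qed

text \<open>
  The local form of the weak (1,1) bound: for levels above \<open>3\<^sup>n m\<close> only cubes smaller than the
  given one matter, since a larger cube has a threefold enlargement that contains \<open>z\<close>.
\<close>

lemma maximal_local_weak_type:
  fixes f :: "real ^ 'n \<Rightarrow> real" and a z :: "real ^ 'n" and l m s :: real
  assumes f: "f \<in> borel_measurable lebesgue" and l: "0 < l" and z: "z \<in> cube a l"
    and m: "maximal f z \<le> ennreal m" "0 \<le> m" and s: "3 ^ CARD('n) * m < s"
  shows "ennreal s * emeasure lebesgue {x \<in> cube a l. ennreal s < maximal f x}
    \<le> ennreal ((30 * CARD('n)) ^ CARD('n) * l ^ CARD('n) * m)"
proof -
  define d where "d = CARD('n)"
  have "0 \<le> 3 ^ CARD('n) * m" using m(2) by simp
  then have s0: "0 < s" using s by linarith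
  have d0: "0 < d" by (simp add: d_def)
  let ?H = "\<lambda>t. ennreal \<bar>f t\<bar>"
  define I where "I = (\<lambda>p :: (real ^ 'n) \<times> real. \<integral>\<^sup>+t\<in>cube (fst p) (snd p). ?H t \<partial>lebesgue)"
  \<comment> \<open>\<open>T\<close> is the cube tripled about its centre. It contains
    \<open>z\<close> and every cube of side at most \<open>l\<close> that meets the given one.
    \<open>K\<close> lists, by corner and side, cubes inside \<open>T\<close> of side at most
    \<open>l\<close> on which the average of \<open>\<bar>f\<bar>\<close> exceeds
    \<open>s\<close>.\<close>
  define T where "T = cube (\<chi> i. a $ i - l) (3 * l)"
  define K where "K = {p :: (real ^ 'n) \<times> real. 0 < snd p \<and> snd p \<le> l \<and> cube (fst p) (snd p) \<subseteq> T \<and>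
      ennreal s * ennreal (snd p ^ d) < I p}"
  define c :: "(real ^ 'n) \<times> real \<Rightarrow> real ^ 'n" where "c = (\<lambda>p. \<chi> i. fst p $ i + snd p / 2)"
  define \<rho> where "\<rho> = (\<lambda>p :: (real ^ 'n) \<times> real. d * snd p)"
  let ?S = "{x \<in> cube a l. ennreal s < maximal f x}"
  have "z \<in> T"
    unfolding T_def mem_cube
  proof
    fix i
    have "a $ i \<le> z $ i \<and> z $ i \<le> a $ i + l" using z by (auto simp: mem_cube)
    then show "(\<chi> i. a $ i - l) $ i \<le> z $ i \<and> z $ i \<le> (\<chi> i. a $ i - l) $ i + 3 * l"
      using l by auto
  qed
  have cover: "\<exists>p\<in>K. x \<in> cube (fst p) (snd p)" if x: "x \<in> ?S" for x
  proof -
    obtain b r where br: "0 < r" "x \<in> cube b r" "ennreal s * ennreal (r ^ d) < I (b, r)"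
      using x unfolding less_maximal_iff by (auto simp: d_def I_def)
    have "r \<le> l"
    proof (rule ccontr)
      assume "\<not> r \<le> l"
      then have rl: "l < r" by simp
      define R where "R = cube (\<chi> i. b $ i - r) (3 * r)"
      have "cube b r \<subseteq> R" unfolding R_def using br(1) by (intro cube_subset_cubeI) auto
      have "b $ i - r \<le> z $ i \<and> z $ i \<le> b $ i - r + 3 * r" for i
      proof -
        have "b $ i \<le> x $ i \<and> x $ i \<le> b $ i + r" "a $ i \<le> x $ i \<and> x $ i \<le> a $ i + l"
          "a $ i \<le> z $ i \<and> z $ i \<le> a $ i + l"
          using br(2) x z by (auto simp: mem_cube)
        then show ?thesis using rl by linarith
      qed
      then have "z \<in> R" by (simp add: R_def mem_cube)
      have "I (b, r) \<le> (\<integral>\<^sup>+t\<in>R. ?H t \<partial>lebesgue)"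
        using cube_mono_integral[of b r] \<open>cube b r \<subseteq> R\<close> by (simp add: I_def R_def)
      also have "\<dots> \<le> maximal f z * ennreal ((3 * r) ^ d)"
        using \<open>z \<in> R\<close> br(1) unfolding R_def d_def by (intro integral_cube_le_maximal) auto
      also have "\<dots> \<le> ennreal m * ennreal ((3 * r) ^ d)" by (intro mult_right_mono m) simp
      also have "\<dots> = ennreal (3 ^ d * m * r ^ d)"
        using m(2) br(1) unfolding power_mult_distrib
        by (subst ennreal_mult[symmetric]) (auto simp: mult_ac)
      also have "\<dots> \<le> ennreal (s * r ^ d)"
        using s br(1) by (intro ennreal_leI mult_right_mono) (auto simp: d_def)
      also have "\<dots> = ennreal s * ennreal (r ^ d)" using s0 br(1) by (simp add: ennreal_mult)
      finally show False using br(3) by simp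
    qed
    have "cube b r \<subseteq> T"
      unfolding T_def
    proof (rule cube_subset_cubeI)
      fix i
      have "b $ i \<le> x $ i \<and> x $ i \<le> b $ i + r" "a $ i \<le> x $ i \<and> x $ i \<le> a $ i + l"
        using br(2) x by (auto simp: mem_cube)
      then show "(\<chi> i. a $ i - l) $ i \<le> b $ i" "b $ i + r \<le> (\<chi> i. a $ i - l) $ i + 3 * l"
        using \<open>r \<le> l\<close> by auto
    qed
    then have "(b, r) \<in> K" using br \<open>r \<le> l\<close> by (simp add: K_def)
    then show ?thesis using br(2) by force
  qed
  have cub: "cube (fst p) (snd p) \<subseteq> cball (c p) (\<rho> p)" if "p \<in> K" for p
    using cube_subset_cball[of "snd p" "fst p"] that by (simp add: K_def c_def \<rho>_def d_def)
  have "?S \<subseteq> (\<Union>p\<in>K. cball (c p) (\<rho> p))"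
  proof
    fix x assume "x \<in> ?S"
    then obtain p where "p \<in> K" "x \<in> cube (fst p) (snd p)" using cover by blast
    then show "x \<in> (\<Union>p\<in>K. cball (c p) (\<rho> p))" using cub by blast
  qed
  moreover have "0 < \<rho> p \<and> \<rho> p \<le> d * l" if "p \<in> K" for p
    using that d0 by (auto simp: K_def \<rho>_def)
  ultimately obtain C where C: "countable C" "C \<subseteq> K"
    "pairwise (\<lambda>i j. disjnt (cball (c i) (\<rho> i)) (cball (c j) (\<rho> j))) C"
    "?S \<subseteq> (\<Union>i\<in>C. cball (c i) (5 * \<rho> i))"
    by (rule Vitali_covering_lemma_cballs)
  \<comment> \<open>\<open>W p\<close> is the cube circumscribed about the fivefold ball, so its
    side is \<open>10 * d\<close> times the side \<open>snd p\<close> of the original cube.\<close>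
  define W where "W = (\<lambda>p. cube (\<chi> i. c p $ i - 5 * \<rho> p) (2 * (5 * \<rho> p)))"
  have W: "?S \<subseteq> (\<Union>p\<in>C. W p)"
  proof -
    have "cball (c p) (5 * \<rho> p) \<subseteq> W p" for p
      unfolding W_def by (rule cball_subset_cube)
    then show ?thesis using C(4) by blast
  qed
  have "(\<integral>\<^sup>+x\<in>?S. 1 \<partial>lebesgue) \<le> (\<integral>\<^sup>+p. (\<integral>\<^sup>+x\<in>W p. 1 \<partial>lebesgue) \<partial>count_space C)"
    using C(1) W by (rule nn_integral_le_countable_cover) (auto simp: W_def)
  then have "ennreal s * emeasure lebesgue ?S \<le> ennreal s * (\<integral>\<^sup>+p. emeasure lebesgue (W p) \<partial>count_space C)"
    by (intro mult_left_mono) (auto simp: W_def)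
  also have "\<dots> = (\<integral>\<^sup>+p. ennreal s * emeasure lebesgue (W p) \<partial>count_space C)"
    by (simp add: nn_integral_cmult)
  also have "\<dots> \<le> (\<integral>\<^sup>+p. ennreal ((10 * d) ^ d) * I p \<partial>count_space C)"
  proof (rule nn_integral_mono)
    fix p assume "p \<in> space (count_space C)"
    then have p: "p \<in> K" using C(2) by auto
    then have p0: "0 < snd p" by (simp add: K_def)
    have "emeasure lebesgue (W p) = ennreal ((2 * (5 * \<rho> p)) ^ d)"
      unfolding W_def d_def using p0 by (intro emeasure_cube) (simp add: \<rho>_def)
    also have "(2 * (5 * \<rho> p)) ^ d = ((10 * d) * snd p) ^ d"
      unfolding \<rho>_def by (rule arg_cong[of _ _ "\<lambda>x. x ^ d"]) simp
    also have "\<dots> = real ((10 * d) ^ d) * snd p ^ d"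
      by (simp only: power_mult_distrib[of "real (10 * d)"] of_nat_power)
    also have "ennreal \<dots> = ennreal ((10 * d) ^ d) * ennreal (snd p ^ d)"
      using p0 by (intro ennreal_mult) auto
    finally have "ennreal s * emeasure lebesgue (W p) = ennreal ((10 * d) ^ d) * (ennreal s * ennreal (snd p ^ d))"
      by (simp add: mult_ac)
    also have "\<dots> \<le> ennreal ((10 * d) ^ d) * I p"
      using p by (intro mult_left_mono) (auto simp: K_def)
    finally show "ennreal s * emeasure lebesgue (W p) \<le> ennreal ((10 * d) ^ d) * I p" .
  qed
  also have "\<dots> = ennreal ((10 * d) ^ d) * (\<integral>\<^sup>+p. I p \<partial>count_space C)"
    by (simp add: nn_integral_cmult)
  \<comment> \<open>The selected balls are disjoint, hence so are the cubes inside them, and all of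
    these lie in \<open>T\<close>.\<close>
  also have "\<dots> \<le> ennreal ((10 * d) ^ d) * (\<integral>\<^sup>+t\<in>T. ?H t \<partial>lebesgue)"
    unfolding I_def
  proof (intro mult_left_mono nn_integral_disjoint_family_le)
    show "disjoint_family_on (\<lambda>p. cube (fst p) (snd p)) C"
      unfolding disjoint_family_on_def
    proof (intro ballI impI)
      fix p q assume "p \<in> C" "q \<in> C" "p \<noteq> q"
      then have "disjnt (cball (c p) (\<rho> p)) (cball (c q) (\<rho> q))"
        using C(3) by (auto simp: pairwise_def)
      then show "cube (fst p) (snd p) \<inter> cube (fst q) (snd q) = {}"
        using cub \<open>p \<in> C\<close> \<open>q \<in> C\<close> C(2) unfolding disjnt_def by blast
    qed
  next
    show "cube (fst p) (snd p) \<subseteq> T" if "p \<in> C" for p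
      using that C(2) unfolding K_def by blast
  qed (use f C(1) in simp_all)
  also have "\<dots> \<le> ennreal ((10 * d) ^ d) * (ennreal m * ennreal ((3 * l) ^ d))"
  proof (rule mult_left_mono)
    have "(\<integral>\<^sup>+t\<in>T. ?H t \<partial>lebesgue) \<le> maximal f z * ennreal ((3 * l) ^ d)"
      using \<open>z \<in> T\<close> l unfolding T_def d_def by (intro integral_cube_le_maximal) auto
    also have "\<dots> \<le> ennreal m * ennreal ((3 * l) ^ d)" by (intro mult_right_mono m) simp
    finally show "(\<integral>\<^sup>+t\<in>T. ?H t \<partial>lebesgue) \<le> ennreal m * ennreal ((3 * l) ^ d)" .
  qed simp
  \<comment> \<open>The constant combines \<open>(10 * d) ^ d\<close> from the enlarged cubes with
    \<open>3 ^ d\<close> from the volume of \<open>T\<close>.\<close>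
  also have "\<dots> = ennreal ((30 * d) ^ d * l ^ d * m)"
  proof -
    have e1: "(30 * real d) ^ d = (10 * real d) ^ d * 3 ^ d"
      by (subst power_mult_distrib[symmetric]) simp
    have e2: "(3 * l) ^ d = 3 ^ d * l ^ d" by (rule power_mult_distrib)
    have "real ((10 * d) ^ d) * (m * (3 * l) ^ d) = (30 * real d) ^ d * l ^ d * m"
      unfolding e1 e2 of_nat_power of_nat_mult of_nat_numeral by (simp only: mult_ac)
    moreover have "ennreal ((10 * d) ^ d) * (ennreal m * ennreal ((3 * l) ^ d)) = ennreal (real ((10 * d) ^ d) * (m * (3 * l) ^ d))"
      using l m(2) by (simp add: ennreal_mult)
    ultimately show ?thesis by (simp only: of_nat_power of_nat_mult of_nat_numeral)
  qed
  finally show ?thesis by (simp add: d_def)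
qed

section \<open>Finiteness and positivity of the maximal function\<close>

text \<open>An infinite \<open>E\<close> contradicts the bound at once. A finite positive
  \<open>E\<close> contradicts it for large \<open>s\<close>: the test value
  \<open>s1 + \<bar>c\<bar> / e\<close> makes the left side exceed \<open>\<bar>c\<bar>\<close>,
  which also covers negative \<open>c\<close>.\<close>

lemma ennreal_eq_0_of_scaled_bound:
  assumes "\<And>s. s0 < s \<Longrightarrow> ennreal s * E \<le> ennreal c"
  shows "E = 0"
proof (rule ccontr)
  assume E: "E \<noteq> 0"
  define s1 where "s1 = max s0 0 + 1"
  have s1: "s0 < s1" "0 < s1" by (auto simp: s1_def)
  have "E \<noteq> top"
    using assms[OF s1(1)] s1(2) by (auto simp: ennreal_mult_top top_unique)
  with E obtain e where e: "E = ennreal e" "0 < e"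
    by (cases E) (auto simp: less_le)
  have "0 \<le> \<bar>c\<bar> / e" using e by simp
  then have "ennreal (s1 + \<bar>c\<bar> / e) * E \<le> ennreal c"
    using s1 by (intro assms) linarith
  also have "ennreal (s1 + \<bar>c\<bar> / e) * E = ennreal (s1 * e + \<bar>c\<bar>)"
  proof -
    have "(s1 + \<bar>c\<bar> / e) * e = s1 * e + \<bar>c\<bar>" using e by (simp add: distrib_right)
    then show ?thesis using e ennreal_mult''[of e "s1 + \<bar>c\<bar> / e"] by simp
  qed
  finally have "ennreal (s1 * e + \<bar>c\<bar>) \<le> ennreal c" .
  moreover have "0 < s1 * e" using e s1 by simp
  ultimately show False by (auto simp: ennreal_le_iff2 simp del: ennreal_plus)
qed

lemma UN_cubes: "\<exists>k::nat. (x :: real ^ 'n) \<in> cube (\<chi> i. a $ i - real k) (2 * real k + l)" if "0 \<le> l"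
proof -
  obtain k :: nat where k: "norm (x - a) \<le> k" using real_arch_simple by blast
  have "a $ i - k \<le> x $ i \<and> x $ i \<le> a $ i - k + (2 * real k + l)" for i
  proof -
    have "\<bar>x $ i - a $ i\<bar> \<le> k"
      using k component_le_norm_cart[of "x - a" i] by simp
    then show ?thesis using that by linarith
  qed
  then show ?thesis by (intro exI[of _ k]) (simp add: mem_cube)
qed

text \<open>The local weak type bound at \<open>z = x0\<close> controls \<open>s\<close> times the
  measure of the infinity set in any cube around \<open>x0\<close>, with a bound free of
  \<open>s\<close>. Letting \<open>s\<close> grow makes that set null, and countably many such cubes
  exhaust the space.\<close>

lemma AE_maximal_finite:
  fixes f :: "real ^ 'n \<Rightarrow> real"
  assumes f: "f \<in> borel_measurable lebesgue" and "maximal f x0 < \<infinity>"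
  shows "AE x in lebesgue. maximal f x < \<infinity>"
proof -
  obtain m where m: "maximal f x0 = ennreal m" "0 \<le> m"
    using assms(2) by (cases "maximal f x0") auto
  have "AE x in lebesgue. \<not> (x \<in> cube (\<chi> i. x0 $ i - real k) (2 * real k + 1) \<and> maximal f x = \<infinity>)" for k :: nat
  proof -
    let ?Q = "cube (\<chi> i. x0 $ i - real k) (2 * real k + 1)"
    let ?E = "{x. x \<in> ?Q \<and> maximal f x = \<infinity>}"
    have meas: "?E \<in> sets lebesgue"
    proof -
      have "?E = ?Q \<inter> {x \<in> space lebesgue. maximal f x = \<infinity>}" by auto
      also have "\<dots> \<in> sets lebesgue" by (intro sets.Int cube_sets) measurable
      finally show ?thesis .
    qed
    have "emeasure lebesgue ?E = 0"
    proof (rule ennreal_eq_0_of_scaled_bound)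
      fix s assume s: "3 ^ CARD('n) * m < s"
      have "ennreal s * emeasure lebesgue ?E \<le> ennreal s * emeasure lebesgue {x \<in> ?Q. ennreal s < maximal f x}"
      proof (intro mult_left_mono emeasure_mono)
        have "{x \<in> ?Q. ennreal s < maximal f x} = ?Q \<inter> {x. ennreal s < maximal f x}" by auto
        then show "{x \<in> ?Q. ennreal s < maximal f x} \<in> sets lebesgue"
          using open_maximal_greater[of "ennreal s" f] by (auto intro!: sets.Int borel_open)
      qed auto
      also have "\<dots> \<le> ennreal (real ((30 * CARD('n)) ^ CARD('n)) * (2 * real k + 1) ^ CARD('n) * m)"
        using f m s by (intro maximal_local_weak_type[where z = x0]) (auto simp: mem_cube)
      finally show "ennreal s * emeasure lebesgue ?E \<le> ennreal (real ((30 * CARD('n)) ^ CARD('n)) * (2 * real k + 1) ^ CARD('n) * m)" .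
    qed
    then show ?thesis using meas by (intro AE_I[where N = ?E]) auto
  qed
  then have "AE x in lebesgue. \<forall>k::nat. \<not> (x \<in> cube (\<chi> i. x0 $ i - real k) (2 * real k + 1) \<and> maximal f x = \<infinity>)"
    by (simp only: AE_all_countable) blast
  then show ?thesis
  proof eventually_elim
    case (elim x)
    then show ?case using UN_cubes[of 1 x x0] by (auto simp: less_top)
  qed
qed

text \<open>Some concentric enlargement \<open>Q k\<close> of the cube carries positive mass of
  \<open>\<bar>f\<bar>\<close>. It contains every point of the cube, so its average is a common
  lower bound for \<open>maximal f\<close> there.\<close>

lemma INF_maximal_pos:
  fixes f :: "real ^ 'n \<Rightarrow> real"
  assumes f: "f \<in> borel_measurable lebesgue" and "\<not> (AE x in lebesgue. f x = 0)" and l: "0 < l"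
  shows "0 < (INF x\<in>cube a l. maximal f x)"
proof -
  define Q where "Q = (\<lambda>k::nat. cube (\<chi> i. a $ i - real k) (2 * real k + l))"
  have "\<exists>k. (\<integral>\<^sup>+x\<in>Q k. ennreal \<bar>f x\<bar> \<partial>lebesgue) \<noteq> 0"
  proof (rule ccontr)
    assume "\<nexists>k. (\<integral>\<^sup>+x\<in>Q k. ennreal \<bar>f x\<bar> \<partial>lebesgue) \<noteq> 0"
    then have "AE x in lebesgue. ennreal \<bar>f x\<bar> * indicator (Q k) x = 0" for k
      using f by (subst (asm) nn_integral_0_iff_AE) (auto simp: Q_def)
    then have "AE x in lebesgue. \<forall>k. ennreal \<bar>f x\<bar> * indicator (Q k) x = 0"
      by (simp only: AE_all_countable) blast
    then have "AE x in lebesgue. f x = 0"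
    proof eventually_elim
      case (elim x)
      obtain k where "x \<in> Q k" using UN_cubes[of l x a] l unfolding Q_def by auto
      then show ?case using elim[rule_format, of k] by simp
    qed
    then show False using assms(2) by simp
  qed
  then obtain k where k: "(\<integral>\<^sup>+x\<in>Q k. ennreal \<bar>f x\<bar> \<partial>lebesgue) \<noteq> 0" by blast
  have sub: "cube a l \<subseteq> Q k" unfolding Q_def by (intro cube_subset_cubeI) auto
  have "0 < avg (Q k) (\<lambda>x. ennreal \<bar>f x\<bar>)"
    unfolding Q_def using l k by (subst avg_cube_iff) (auto simp: Q_def zero_less_iff_neq_zero)
  also have "\<dots> \<le> (INF x\<in>cube a l. maximal f x)"
    using sub l unfolding maximal_def Q_def cubes_eq by (intro INF_greatest SUP_upper) force
  finally show ?thesis .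
qed

lemma maximal_pos:
  fixes f :: "real ^ 'n \<Rightarrow> real"
  assumes "f \<in> borel_measurable lebesgue" "\<not> (AE x in lebesgue. f x = 0)"
  shows "0 < maximal f x"
proof -
  have "0 < (INF x\<in>cube x 1. maximal f x)" using assms by (rule INF_maximal_pos) simp
  also have "\<dots> \<le> maximal f x" by (intro INF_lower) (simp add: mem_cube)
  finally show ?thesis .
qed

section \<open>Kolmogorov's inequality: powers of the maximal function as A_1 weights\<close>

text \<open>A discrete layer cake formula: for finite \<open>F\<close> above \<open>T\<close>, the
  term with \<open>2 ^ k * T < F \<le> 2 ^ Suc k * T\<close> already suffices. Since
  \<open>enn2real\<close> maps infinity to 0, an infinite \<open>F\<close> falls under the first
  case of the proof.\<close>

lemma dyadic_layer_bound:
  fixes T \<gamma> :: real and F :: ennreal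
  assumes "0 < T" "0 \<le> \<gamma>"
  shows "ennreal (enn2real F powr \<gamma>) \<le> ennreal (T powr \<gamma>) +
    (\<Sum>k. ennreal ((2 ^ Suc k * T) powr \<gamma>) * (if ennreal (2 ^ k * T) < F then 1 else 0))"
proof (cases "enn2real F \<le> T")
  case True
  then have "ennreal (enn2real F powr \<gamma>) \<le> ennreal (T powr \<gamma>)"
    using assms by (intro ennreal_leI powr_mono2) auto
  then show ?thesis by (rule order_trans) simp
next
  case False
  define y where "y = enn2real F"
  have y: "T < y" using False by (simp add: y_def)
  have F: "F = ennreal y" "F \<noteq> top"
    using y assms(1) unfolding y_def by (cases F; auto)+
  define P where "P = (\<lambda>j::nat. y \<le> 2 ^ j * T)"
  obtain j :: nat where "y / T < 2 ^ j" using real_arch_pow[of 2 "y / T"] by auto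
  then have "P j" using assms by (simp add: P_def field_simps)
  moreover have "\<not> P 0" using y by (simp add: P_def)
  ultimately obtain k where k: "\<not> P k" "P (Suc k)"
    using ex_least_nat_less[of P j] by blast
  let ?a = "\<lambda>k. ennreal ((2 ^ Suc k * T) powr \<gamma>) * (if ennreal (2 ^ k * T) < F then 1 else 0)"
  have "ennreal (y powr \<gamma>) \<le> ?a k"
    using k assms y F by (auto simp: P_def not_le intro!: ennreal_leI powr_mono2) (auto simp: ennreal_less_iff)
  also have "?a k = sum ?a {k}" by simp
  also have "\<dots> \<le> (\<Sum>k. ?a k)" by (rule sum_le_suminf) auto
  finally show ?thesis unfolding y_def by (rule order_trans) simp
qed

text \<open>The number \<open>r\<close> is the infimum of \<open>maximal f\<close> on the cube.
  Integrating the dyadic layers above a multiple of \<open>r\<close> with the local weak type bound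
  gives a geometric series, convergent because \<open>\<gamma> < 1\<close>. Exposing
  \<open>r\<close> rather than an A_1 constant lets the infima of two weights be handled separately
  later.\<close>

lemma maximal_powr_A1:
  fixes \<gamma> :: real
  assumes "0 \<le> \<gamma>" "\<gamma> < 1"
  obtains C where "0 < C" and "\<And>(f :: real ^ 'n \<Rightarrow> real) x0 a l. f \<in> borel_measurable lebesgue \<Longrightarrow>
    \<not> (AE x in lebesgue. f x = 0) \<Longrightarrow> maximal f x0 < \<infinity> \<Longrightarrow> 0 < l \<Longrightarrow>
    \<exists>r>0. (\<forall>x\<in>cube a l. ennreal r \<le> maximal f x) \<and>
      (\<integral>\<^sup>+x\<in>cube a l. ennreal (enn2real (maximal f x) powr \<gamma>) \<partial>lebesgue)
        \<le> ennreal (C * r powr \<gamma> * l ^ CARD('n))"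
proof -
  define d where "d = CARD('n)"
  \<comment> \<open>Ratio of the series: raising the level by a factor 2 multiplies the power by
    \<open>2 powr \<gamma>\<close> and halves the weak type bound.\<close>
  define q where "q = 2 powr (\<gamma> - 1)"
  define c where "c = (30 * real d) ^ d"
  define C where "C = (4 * 3 ^ d) powr \<gamma> * (1 + 2 powr \<gamma> * c / (1 - q))"
  have q: "0 < q" "q < 1"
    using assms powr_less_mono[of "\<gamma> - 1" 0 2] by (auto simp: q_def)
  have c: "0 \<le> c" by (simp add: c_def)
  have C: "0 < C" using q c unfolding C_def
    by (intro mult_pos_pos add_pos_nonneg) auto
  have "\<exists>r>0. (\<forall>x\<in>cube a l. ennreal r \<le> maximal f x) \<and>
      (\<integral>\<^sup>+x\<in>cube a l. ennreal (enn2real (maximal f x) powr \<gamma>) \<partial>lebesgue)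
        \<le> ennreal (C * r powr \<gamma> * l ^ CARD('n))"
    if f: "f \<in> borel_measurable lebesgue" and nz: "\<not> (AE x in lebesgue. f x = 0)"
      and x0: "maximal f x0 < \<infinity>" and l: "0 < l" for f :: "real ^ 'n \<Rightarrow> real" and x0 a l
  proof -
    let ?Q = "cube a l"
    define v where "v = (INF x\<in>?Q. maximal f x)"
    have v0: "0 < v" unfolding v_def using f nz l by (rule INF_maximal_pos)
    have "\<exists>x\<in>?Q. maximal f x < \<infinity>"
    proof (rule ccontr)
      assume "\<not> ?thesis"
      then have "AE x in lebesgue. x \<notin> ?Q"
        using AE_maximal_finite[OF f x0] by (auto elim!: eventually_mono)
      then show False by (rule cube_not_AE[OF l])
    qed
    then have "v < \<infinity>" unfolding v_def by (auto simp: INF_less_iff)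
    then obtain r where r: "v = ennreal r" "0 < r"
      using v0 by (cases v) auto
    \<comment> \<open>A point \<open>z\<close> where the infimum is almost attained serves as the
      reference point of the local weak type bound, with \<open>m = 2 * r\<close>.\<close>
    have "v < ennreal (2 * r)" using r by (auto simp: ennreal_less_iff)
    then obtain z where z: "z \<in> ?Q" "maximal f z < ennreal (2 * r)"
      unfolding v_def by (auto simp: INF_less_iff)
    \<comment> \<open>Twice the threshold \<open>3 ^ d * (2 * r)\<close>, so every level
      \<open>2 ^ k * T\<close> is admissible in the local weak type bound.\<close>
    define T where "T = 4 * 3 ^ d * r"
    have T: "0 < T" using r by (simp add: T_def)
    let ?E = "\<lambda>k. {x \<in> ?Q. ennreal (2 ^ k * T) < maximal f x}"
    have E: "?E k \<in> sets lebesgue" for k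
    proof -
      have "?E k = ?Q \<inter> {x. ennreal (2 ^ k * T) < maximal f x}" by auto
      then show ?thesis
        using open_maximal_greater[of "ennreal (2 ^ k * T)" f] by (auto intro!: sets.Int borel_open)
    qed
    have layer: "ennreal ((2 ^ Suc k * T) powr \<gamma>) * emeasure lebesgue (?E k)
        \<le> ennreal (T powr \<gamma> * l ^ d * (2 powr \<gamma> * c) * q ^ k)" for k
    proof -
      let ?s = "2 ^ k * T"
      have "3 ^ d * (2 * r) < T" using r by (simp add: T_def)
      also have "T \<le> ?s" using T by simp
      finally have s: "3 ^ d * (2 * r) < ?s" .
      have "ennreal ?s * emeasure lebesgue (?E k) \<le> ennreal ((30 * CARD('n)) ^ CARD('n) * l ^ CARD('n) * (2 * r))"
        using f l z r s by (intro maximal_local_weak_type[where z = z]) (auto simp: d_def)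
      also have "\<dots> = ennreal (c * l ^ d * (2 * r))"
        by (simp add: c_def d_def)
      also have "\<dots> \<le> ennreal (c * l ^ d * T)"
      proof (intro ennreal_leI mult_left_mono)
        have "1 \<le> (3::real) ^ d" by simp
        then have "2 * r \<le> 4 * r * 3 ^ d" using r mult_mono[of "2 * r" "4 * r" 1 "3 ^ d"] by simp
        then show "2 * r \<le> T" unfolding T_def by (simp add: mult.commute mult.left_commute)
      qed (use c l in auto)
      finally have b: "ennreal ?s * emeasure lebesgue (?E k) \<le> ennreal (c * l ^ d * T)" .
      \<comment> \<open>Dividing the height of a layer by its level isolates the geometric factor
        \<open>q ^ k\<close>; the level \<open>?s\<close> is then absorbed by the weak type
        bound.\<close>
      have "(2 ^ Suc k * T) powr \<gamma> / ?s = T powr \<gamma> / T * 2 powr \<gamma> * q ^ k"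
      proof -
        have "q ^ k = 2 powr (k * (\<gamma> - 1))"
          by (simp add: q_def powr_realpow[symmetric] powr_powr mult.commute)
        also have "\<dots> = (2 ^ k) powr \<gamma> / 2 ^ k"
          by (simp add: powr_diff right_diff_distrib powr_realpow[symmetric] powr_powr)
        finally show ?thesis using T by (simp add: powr_mult field_simps)
      qed
      then have e: "(2 ^ Suc k * T) powr \<gamma> = (T powr \<gamma> / T * 2 powr \<gamma> * q ^ k) * ?s"
        using T by (simp add: field_simps)
      have "ennreal ((2 ^ Suc k * T) powr \<gamma>) * emeasure lebesgue (?E k)
          = ennreal (T powr \<gamma> / T * 2 powr \<gamma> * q ^ k) * (ennreal ?s * emeasure lebesgue (?E k))"
        unfolding e using T q by (subst ennreal_mult) (auto simp: mult.assoc)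
      also have "\<dots> \<le> ennreal (T powr \<gamma> / T * 2 powr \<gamma> * q ^ k) * ennreal (c * l ^ d * T)"
        by (intro mult_left_mono b) simp
      also have "\<dots> = ennreal (T powr \<gamma> / T * 2 powr \<gamma> * q ^ k * (c * l ^ d * T))"
        using T q c l by (intro ennreal_mult[symmetric]) auto
      also have "T powr \<gamma> / T * 2 powr \<gamma> * q ^ k * (c * l ^ d * T) = T powr \<gamma> * l ^ d * (2 powr \<gamma> * c) * q ^ k"
        using T by simp
      finally show ?thesis .
    qed
    have "(\<integral>\<^sup>+x\<in>?Q. ennreal (enn2real (maximal f x) powr \<gamma>) \<partial>lebesgue)
        \<le> (\<integral>\<^sup>+x. ennreal (T powr \<gamma>) * indicator ?Q x +
            (\<Sum>k. ennreal ((2 ^ Suc k * T) powr \<gamma>) * indicator (?E k) x) \<partial>lebesgue)"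
    proof (rule nn_integral_mono)
      fix x
      show "ennreal (enn2real (maximal f x) powr \<gamma>) * indicator ?Q x \<le> ennreal (T powr \<gamma>) * indicator ?Q x +
            (\<Sum>k. ennreal ((2 ^ Suc k * T) powr \<gamma>) * indicator (?E k) x)"
      proof (cases "x \<in> ?Q")
        case True
        then have "indicator (?E k) x = (if ennreal (2 ^ k * T) < maximal f x then 1 else 0 :: ennreal)" for k
          by (simp add: indicator_def)
        then show ?thesis using True dyadic_layer_bound[OF T assms(1), of "maximal f x"] by simp
      qed simp
    qed
    also have "\<dots> = ennreal (T powr \<gamma>) * emeasure lebesgue ?Q +
        (\<Sum>k. ennreal ((2 ^ Suc k * T) powr \<gamma>) * emeasure lebesgue (?E k))"
      using E by (simp add: nn_integral_add nn_integral_suminf nn_integral_cmult_indicator del: emeasure_completion)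
    also have "\<dots> \<le> ennreal (T powr \<gamma>) * ennreal (l ^ d) +
        (\<Sum>k. ennreal (T powr \<gamma> * l ^ d * (2 powr \<gamma> * c) * q ^ k))"
      using l by (intro add_mono mult_left_mono suminf_le layer) (auto simp: d_def emeasure_cube simp del: emeasure_completion)
    also have "(\<Sum>k. ennreal (T powr \<gamma> * l ^ d * (2 powr \<gamma> * c) * q ^ k)) = ennreal (T powr \<gamma> * l ^ d * (2 powr \<gamma> * c) * (1 / (1 - q)))"
      using q c l by (intro suminf_ennreal_eq sums_mult geometric_sums) auto
    also have "ennreal (T powr \<gamma>) * ennreal (l ^ d) + \<dots> = ennreal (T powr \<gamma> * l ^ d * (1 + 2 powr \<gamma> * c / (1 - q)))"
      using q c l by (simp add: ennreal_mult[symmetric] ennreal_plus[symmetric] distrib_left del: ennreal_plus)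
    also have "T powr \<gamma> * l ^ d * (1 + 2 powr \<gamma> * c / (1 - q)) = C * r powr \<gamma> * l ^ CARD('n)"
      using r by (simp add: T_def C_def powr_mult d_def)
    finally have "(\<integral>\<^sup>+x\<in>?Q. ennreal (enn2real (maximal f x) powr \<gamma>) \<partial>lebesgue)
        \<le> ennreal (C * r powr \<gamma> * l ^ CARD('n))" .
    moreover have "\<forall>x\<in>?Q. ennreal r \<le> maximal f x"
      unfolding r(1)[symmetric] v_def by (auto intro: INF_lower)
    ultimately show ?thesis using r(2) by blast
  qed
  then show ?thesis using that C by blast
qed

section \<open>Pointwise domination of a function by its maximal function\<close>

lemma emeasure_interior_cbox:
  "emeasure lebesgue (interior (cbox a b)) = emeasure lebesgue (cbox (a :: 'a::euclidean_space) b)"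
  by (simp add: emeasure_lborel_cbox_eq emeasure_lborel_box_eq)

text \<open>
  Covers \<open>E\<close> by nonoverlapping cubes inside \<open>U\<close> that meet \<open>E\<close>; on each of them the average of
  \<open>\<bar>f\<bar>\<close> is at most \<open>p\<close>. Outer regularity then gives the a.e. bound \<open>\<bar>f\<bar> \<le> Mf\<close> without the
  Lebesgue differentiation theorem.
\<close>

lemma maximal_small_level_set_bound:
  fixes f :: "real ^ 'n \<Rightarrow> real"
  assumes f: "f \<in> borel_measurable lebesgue" and l: "0 < l"
    and E: "E \<in> sets lebesgue" "E \<subseteq> cube a l"
    and p: "0 \<le> p" and Ep: "\<And>x. x \<in> E \<Longrightarrow> maximal f x \<le> ennreal p"
    and Eq: "\<And>x. x \<in> E \<Longrightarrow> q \<le> \<bar>f x\<bar>" and U: "open U" "E \<subseteq> U"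
  shows "ennreal q * emeasure lebesgue E \<le> ennreal p * emeasure lebesgue U"
proof -
  let ?b = "(\<chi> i. a $ i + l) :: real ^ 'n"
  have "E \<subseteq> cbox a ?b" using E(2) by (simp add: cube_def)
  moreover have "box a ?b \<noteq> {}" using l by (simp add: interval_ne_empty_cart)
  \<comment> \<open>The gauge equals \<open>U\<close> at points of \<open>U\<close>, so every
    covering piece tagged by a point of \<open>E\<close> lies inside \<open>U\<close>.\<close>
  moreover have "gauge (\<lambda>x. if x \<in> U then U else UNIV)" using U(1) by (auto simp: gauge_def)
  ultimately obtain D where D: "countable D"
    "\<And>K. K \<in> D \<Longrightarrow> interior K \<noteq> {} \<and> (\<exists>c d. K = cbox c d)"
    "pairwise (\<lambda>A B. interior A \<inter> interior B = {}) D"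
    "\<And>K. K \<in> D \<Longrightarrow> \<exists>x \<in> E \<inter> K. K \<subseteq> (if x \<in> U then U else UNIV)"
    "\<And>u v. cbox u v \<in> D \<Longrightarrow> \<exists>n. \<forall>i \<in> Basis. v \<bullet> i - u \<bullet> i = (?b \<bullet> i - a \<bullet> i) / 2 ^ n"
    "E \<subseteq> \<Union>D"
    by (rule covering_lemma) blast
  have K: "(\<integral>\<^sup>+x\<in>K. ennreal \<bar>f x\<bar> \<partial>lebesgue) \<le> ennreal p * emeasure lebesgue (interior K)"
      "K \<in> sets lebesgue" "K \<subseteq> U"
    if KD: "K \<in> D" for K
  proof -
    obtain u v where uv: "K = cbox u v" using D(2)[OF KD] by blast
    \<comment> \<open>Dyadic subdivision scales all edges of the cube by the same factor, so each
      piece is again a cube and its average is controlled by \<open>maximal f\<close>.\<close>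
    obtain n where n: "\<forall>i \<in> Basis. v \<bullet> i - u \<bullet> i = (?b \<bullet> i - a \<bullet> i) / 2 ^ n"
      using D(5) KD uv by blast
    have "v $ i = u $ i + l / 2 ^ n" for i
    proof -
      have "axis i (1::real) \<in> Basis" by simp
      then show ?thesis using n[rule_format, of "axis i 1"] by (simp add: inner_axis)
    qed
    then have Kc: "K = cube u (l / 2 ^ n)"
      unfolding uv cube_def by (intro arg_cong2[of _ _ _ _ cbox]) (simp_all add: vec_eq_iff)
    obtain x where x: "x \<in> E" "x \<in> K" "K \<subseteq> U" using D(4)[OF KD] U(2) by auto
    have "(\<integral>\<^sup>+x\<in>K. ennreal \<bar>f x\<bar> \<partial>lebesgue) \<le> maximal f x * ennreal ((l / 2 ^ n) ^ CARD('n))"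
      using x l unfolding Kc by (intro integral_cube_le_maximal) auto
    also have "\<dots> \<le> ennreal p * ennreal ((l / 2 ^ n) ^ CARD('n))"
      using Ep[OF x(1)] by (rule mult_right_mono) simp
    also have "ennreal ((l / 2 ^ n) ^ CARD('n)) = emeasure lebesgue K"
      unfolding Kc using l by (intro emeasure_cube[symmetric]) simp
    also have "emeasure lebesgue K = emeasure lebesgue (interior K)"
      unfolding uv by (rule emeasure_interior_cbox[symmetric])
    finally show "(\<integral>\<^sup>+x\<in>K. ennreal \<bar>f x\<bar> \<partial>lebesgue) \<le> ennreal p * emeasure lebesgue (interior K)" .
    show "K \<in> sets lebesgue" unfolding Kc by simp
    show "K \<subseteq> U" by fact
  qed
  have "ennreal q * emeasure lebesgue E = (\<integral>\<^sup>+x\<in>E. ennreal q \<partial>lebesgue)"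
    using E(1) by (simp add: nn_integral_cmult_indicator del: emeasure_completion)
  also have "\<dots> \<le> (\<integral>\<^sup>+x\<in>E. ennreal \<bar>f x\<bar> \<partial>lebesgue)"
    using Eq by (intro nn_integral_mono) (auto split: split_indicator intro: ennreal_leI)
  also have "\<dots> \<le> (\<integral>\<^sup>+K. (\<integral>\<^sup>+x\<in>K. ennreal \<bar>f x\<bar> \<partial>lebesgue) \<partial>count_space D)"
    using D(1,6) K(2) f by (intro nn_integral_le_countable_cover) auto
  also have "\<dots> \<le> (\<integral>\<^sup>+K. ennreal p * emeasure lebesgue (interior K) \<partial>count_space D)"
    using K(1) by (intro nn_integral_mono) auto
  also have "\<dots> = ennreal p * (\<integral>\<^sup>+K. emeasure lebesgue (interior K) \<partial>count_space D)"
    by (simp add: nn_integral_cmult del: emeasure_completion)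
  \<comment> \<open>The pieces may share boundaries, but their interiors are disjoint and have the
    full measure, so the measures add up inside \<open>U\<close>.\<close>
  also have "(\<integral>\<^sup>+K. emeasure lebesgue (interior K) \<partial>count_space D) = emeasure lebesgue (\<Union>K\<in>D. interior K)"
    using D(1,3) by (intro emeasure_UN_countable[symmetric])
      (auto simp: disjoint_family_on_def pairwise_def)
  also have "ennreal p * \<dots> \<le> ennreal p * emeasure lebesgue U"
  proof (intro mult_left_mono emeasure_mono)
    show "(\<Union>K\<in>D. interior K) \<subseteq> U" using K(3) interior_subset by fastforce
    show "U \<in> sets lebesgue" using U(1) by auto
  qed simp
  finally show ?thesis .
qed

text \<open>Where the bound fails, two rationals \<open>p < q\<close> separate
  \<open>maximal f x\<close> from \<open>\<bar>f x\<bar>\<close>. On such a set inside a bounded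
  cube the covering estimate gives \<open>q\<close> times its measure at most \<open>p\<close> times
  that of any open superset; open supersets of nearly the same measure force measure 0.\<close>

lemma AE_abs_le_maximal:
  fixes f :: "real ^ 'n \<Rightarrow> real"
  assumes f: "f \<in> borel_measurable lebesgue"
  shows "AE x in lebesgue. ennreal \<bar>f x\<bar> \<le> maximal f x"
proof -
  define Q where "Q = (\<lambda>k::nat. cube ((\<chi> i. 0 - real k) :: real ^ 'n) (2 * real k + 1))"
  define E where "E = (\<lambda>(k, p, q). {x \<in> Q k. real_of_rat q \<le> \<bar>f x\<bar> \<and> maximal f x \<le> ennreal (real_of_rat p)})"
  have null: "AE x in lebesgue. x \<notin> E (k, p, q)" if pq: "0 \<le> p" "p < q" for k p q
  proof -
    let ?E = "E (k, p, q)" and ?p = "real_of_rat p" and ?q = "real_of_rat q"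
    have pq': "0 \<le> ?p" "?p < ?q" using pq by (auto simp: of_rat_less)
    have "?E = Q k \<inter> {x \<in> space lebesgue. ?q \<le> \<bar>f x\<bar>} \<inter> {x \<in> space lebesgue. maximal f x \<le> ennreal ?p}"
      by (auto simp: E_def)
    also have "\<dots> \<in> sets lebesgue"
    proof (intro sets.Int)
      show "{x \<in> space lebesgue. maximal f x \<le> ennreal ?p} \<in> sets lebesgue"
        by (rule borel_measurable_le[OF borel_measurable_maximal borel_measurable_const])
      show "{x \<in> space lebesgue. ?q \<le> \<bar>f x\<bar>} \<in> sets lebesgue"
        using f by measurable
    qed (simp add: Q_def)
    finally have E: "?E \<in> sets lebesgue" .
    have sub: "?E \<subseteq> Q k" by (auto simp: E_def)
    have "emeasure lebesgue ?E \<le> emeasure lebesgue (Q k)"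
      using sub by (intro emeasure_mono) (auto simp: Q_def)
    also have "\<dots> = ennreal ((2 * real k + 1) ^ CARD('n))"
      unfolding Q_def by (intro emeasure_cube) simp
    finally have "emeasure lebesgue ?E \<noteq> top" by (auto simp: top_unique simp del: emeasure_completion)
    then obtain e where e: "emeasure lebesgue ?E = ennreal e" "0 \<le> e"
      by (cases "emeasure lebesgue ?E") auto
    have *: "?q * e \<le> ?p * (e + \<epsilon>)" if eps: "0 < \<epsilon>" for \<epsilon>
    proof -
      obtain U where U: "open U" "?E \<subseteq> U" "emeasure lebesgue (U - ?E) < ennreal \<epsilon>"
        using sets_lebesgue_outer_open[OF E eps] by blast
      have "emeasure lebesgue U = emeasure lebesgue (?E \<union> (U - ?E))"
        using U(2) by (simp add: Un_absorb1)
      also have "\<dots> \<le> emeasure lebesgue ?E + emeasure lebesgue (U - ?E)"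
        using E U(1) by (intro emeasure_subadditive sets.Diff) auto
      also have "\<dots> \<le> ennreal e + ennreal \<epsilon>"
        using e U(3) by (intro add_mono) auto
      finally have le: "emeasure lebesgue U \<le> ennreal (e + \<epsilon>)"
        using e eps by simp
      have "ennreal ?q * ennreal e \<le> ennreal ?p * emeasure lebesgue U"
        unfolding e(1)[symmetric]
        using f _ E sub[unfolded Q_def] pq'(1) _ _ U(1,2)
        by (rule maximal_small_level_set_bound) (auto simp: E_def)
      also have "\<dots> \<le> ennreal ?p * ennreal (e + \<epsilon>)"
        by (intro mult_left_mono le) simp
      finally have "ennreal ?q * ennreal e \<le> ennreal ?p * ennreal (e + \<epsilon>)" .
      then have "ennreal (?q * e) \<le> ennreal (?p * (e + \<epsilon>))"
        using ennreal_mult''[OF e(2), of ?q] ennreal_mult'[OF pq'(1), of "e + \<epsilon>"] by (simp only:)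
      then show ?thesis
        using e(2) pq'(1) eps by (subst (asm) ennreal_le_iff) auto
    qed
    have "e = 0"
    proof (rule ccontr)
      assume "e \<noteq> 0"
      then have d: "0 < (?q - ?p) * e" using e pq' by simp
      \<comment> \<open>With this choice the preceding bound would say that
        \<open>\<epsilon> * (p + 1)\<close> is at most \<open>p * \<epsilon>\<close>.\<close>
      define \<epsilon> where "\<epsilon> = (?q - ?p) * e / (?p + 1)"
      have \<epsilon>: "0 < \<epsilon>" "\<epsilon> * (?p + 1) = (?q - ?p) * e"
      proof -
        have "0 < ?p + 1" using pq'(1) by linarith
        then show "0 < \<epsilon>" "\<epsilon> * (?p + 1) = (?q - ?p) * e"
          using d unfolding \<epsilon>_def by (auto intro: divide_pos_pos)
      qed
      have "(?q - ?p) * e \<le> ?p * \<epsilon>"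
        using *[OF \<epsilon>(1)] by (simp add: algebra_simps)
      then have "\<epsilon> * (?p + 1) \<le> ?p * \<epsilon>" unfolding \<epsilon>(2) .
      then show False using \<epsilon>(1) by (simp add: algebra_simps)
    qed
    then show ?thesis using e E by (intro AE_I[where N = ?E]) auto
  qed
  have "AE x in lebesgue. \<forall>i. 0 \<le> fst (snd i) \<and> fst (snd i) < snd (snd i) \<longrightarrow> x \<notin> E i"
    unfolding AE_all_countable using null by (auto intro!: AE_impI)
  then show ?thesis
  proof eventually_elim
    case (elim x)
    show ?case
    proof (rule ccontr)
      assume "\<not> ennreal \<bar>f x\<bar> \<le> maximal f x"
      then have lt: "maximal f x < ennreal \<bar>f x\<bar>" by simp
      then obtain m where m: "maximal f x = ennreal m" "0 \<le> m" by (cases "maximal f x") auto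
      then have "m < \<bar>f x\<bar>" using lt by (simp add: ennreal_less_iff)
      then obtain q where q: "m < real_of_rat q" "real_of_rat q < \<bar>f x\<bar>"
        using of_rat_dense by blast
      then obtain p where p: "m < real_of_rat p" "real_of_rat p < real_of_rat q"
        using of_rat_dense by blast
      obtain k where "x \<in> Q k" using UN_cubes[of 1 x 0] by (auto simp: Q_def)
      then have "x \<in> E (k, p, q)" using m p q by (auto simp: E_def intro: ennreal_leI)
      moreover have "0 < real_of_rat p" using p(1) m(2) by linarith
      then have "0 \<le> p" by simp
      moreover have "p < q" using p(2) by (simp add: of_rat_less)
      ultimately show False using elim[rule_format, of "(k, p, q)"] by auto
    qed
  qed
qed

section \<open>Extended powers and the weak type inequality at a single level\<close>

lemma epowr_ennreal [simp]: "0 \<le> x \<Longrightarrow> epowr (ennreal x) a = ennreal (x powr a)"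
  by (simp add: epowr_def)

lemma epowr_mono:
  assumes "x \<le> y" "0 \<le> a"
  shows "epowr x a \<le> epowr y a"
  using assms unfolding epowr_def
  by (auto simp: top_unique less_top intro!: ennreal_leI powr_mono2 enn2real_mono)

lemma epowr_eq_0_iff: "epowr x a = 0 \<longleftrightarrow> x = 0"
  by (cases x) (auto simp: epowr_def)

lemma ennreal_enn2real_powr_le_epowr: "ennreal (enn2real x powr a) \<le> epowr x a"
  by (simp add: epowr_def)

lemma weak_type_level_bound:
  assumes p: "0 < p" and B: "0 < B" and y: "0 < y"
    and le: "weak_Lp_norm p w g \<le> ennreal B * Lp_norm p w f"
  shows "ennreal (y powr p) * dist_fn w (\<lambda>x. ennreal \<bar>g x\<bar>) y
    \<le> ennreal (B powr p) * (\<integral>\<^sup>+x. ennreal (\<bar>f x\<bar> powr p * w x) \<partial>lebesgue)"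
proof -
  let ?D = "dist_fn w (\<lambda>x. ennreal \<bar>g x\<bar>) y" and ?I = "\<integral>\<^sup>+x. ennreal (\<bar>f x\<bar> powr p * w x) \<partial>lebesgue"
  have "ennreal y * epowr ?D (1 / p) \<le> weak_Lp_norm p w g"
    unfolding weak_Lp_norm_def using y by (intro SUP_upper) simp
  also have "\<dots> \<le> ennreal B * epowr ?I (1 / p)" using le by (simp add: Lp_norm_def)
  finally have *: "ennreal y * epowr ?D (1 / p) \<le> ennreal B * epowr ?I (1 / p)" .
  show ?thesis
  proof (cases ?I)
    case top
    then show ?thesis using B by (simp add: ennreal_mult_top)
  next
    case (real i)
    then have R: "ennreal B * epowr ?I (1 / p) = ennreal (B * i powr (1 / p))"
      using B by (simp add: ennreal_mult)
    \<comment> \<open>The right side is now finite, so an infinite distribution function is excluded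
      and the rest is real arithmetic.\<close>
    have "?D \<noteq> top"
    proof
      assume "?D = top"
      then have "epowr ?D (1 / p) = top" by (simp add: epowr_def)
      then show False using * y R by (simp add: ennreal_mult_top top_unique)
    qed
    then obtain D where D: "?D = ennreal D" "0 \<le> D" by (cases ?D) auto
    have "ennreal (y * D powr (1 / p)) \<le> ennreal (B * i powr (1 / p))"
      using * D y unfolding R by (simp add: ennreal_mult)
    then have "y * D powr (1 / p) \<le> B * i powr (1 / p)" using B by simp
    then have "(y * D powr (1 / p)) powr p \<le> (B * i powr (1 / p)) powr p"
      using y p by (intro powr_mono2) auto
    then have "y powr p * D \<le> B powr p * i"
      using y p B D real by (simp add: powr_mult powr_powr)
    then show ?thesis using D real by (simp add: ennreal_mult[symmetric])
  qed
qed

section \<open>Weights of class A_p built from maximal functions\<close>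

text \<open>\<open>locally_bounded\<close> controls \<open>\<phi>\<close> on bounded parts of the
  open half-line, so the argument of \<open>\<phi>\<close> has to be shown positive. Both averages
  over one fixed cube are positive because \<open>w\<close> is positive a.e.\<close>

lemma Ap_const_pos:
  fixes w :: "real ^ 'n \<Rightarrow> real"
  assumes "weight w"
  shows "0 < Ap_const p w"
proof -
  let ?Q = "cube (0 :: real ^ 'n) 1"
  have w: "w \<in> borel_measurable lebesgue" "AE x in lebesgue. 0 < w x"
    using assms by (auto simp: weight_def locally_integrable_def)
  have pos: "0 < avg ?Q (\<lambda>x. ennreal (v x))"
    if v: "v \<in> borel_measurable lebesgue" "AE x in lebesgue. 0 < v x" for v :: "real ^ 'n \<Rightarrow> real"
  proof -
    have "(\<integral>\<^sup>+x\<in>?Q. ennreal (v x) \<partial>lebesgue) \<noteq> 0"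
    proof
      assume "(\<integral>\<^sup>+x\<in>?Q. ennreal (v x) \<partial>lebesgue) = 0"
      then have "AE x in lebesgue. ennreal (v x) * indicator ?Q x = 0"
        using v by (subst (asm) nn_integral_0_iff_AE) auto
      then have "AE x in lebesgue. x \<notin> ?Q"
        using v(2) by eventually_elim (auto simp: indicator_def split: if_splits)
      then show False by (rule cube_not_AE[rotated]) simp
    qed
    then show ?thesis by (subst avg_cube_iff) (auto simp: zero_less_iff_neq_zero)
  qed
  have "0 < avg ?Q (\<lambda>x. ennreal (w x)) * epowr (avg ?Q (\<lambda>x. ennreal (w x powr (- 1 / (p - 1))))) (p - 1)"
    (is "0 < ?A * epowr ?A' _")
  proof -
    have "0 < ?A" using w by (rule pos)
    moreover have "0 < ?A'" using w by (intro pos) (auto elim!: eventually_mono)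
    ultimately show ?thesis by (simp add: ennreal_zero_less_mult_iff zero_less_iff_neq_zero epowr_eq_0_iff)
  qed
  also have "\<dots> \<le> Ap_const p w"
    unfolding Ap_const_def
  proof (rule SUP_upper)
    show "?Q \<in> cubes" unfolding cubes_eq by (intro CollectI exI[of _ 0] exI[of _ 1]) simp
  qed
  finally show ?thesis .
qed

text \<open>The constant 1 stands in for \<open>f\<close> and \<open>h\<close> where a concrete
  weight is wanted and \<open>f\<close> vanishes a.e.\<close>

lemma maximal_one: "maximal (\<lambda>_. 1) (x :: real ^ 'n) < \<infinity>"
proof -
  have "maximal (\<lambda>_. 1) x \<le> 1"
    unfolding maximal_def
  proof (rule SUP_least)
    fix Q assume "Q \<in> {Q \<in> cubes. x \<in> Q}"
    then obtain a l where Q: "Q = cube a l" "0 < l" by (auto simp: cubes_eq)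
    then show "avg Q (\<lambda>t. ennreal \<bar>1\<bar>) \<le> 1"
      by (simp add: avg_cube_iff emeasure_cube del: emeasure_completion)
  qed
  then show ?thesis by (rule le_less_trans) simp
qed

lemma compact_subset_cube:
  assumes "compact (K :: (real ^ 'n) set)"
  obtains a l where "0 < l" "K \<subseteq> cube a l"
proof -
  obtain B where B: "0 < B" "\<And>x. x \<in> K \<Longrightarrow> norm x \<le> B"
    using compact_imp_bounded[OF assms] by (auto simp: bounded_pos)
  then have "K \<subseteq> cball 0 B" by auto
  also have "\<dots> \<subseteq> cube (\<chi> i. 0 $ i - B) (2 * B)" by (rule cball_subset_cube)
  finally show ?thesis using that[of "2 * B"] B(1) by simp
qed

text \<open>The easy half of the Jones factorization: an A_1 weight times the power
  \<open>1 - p\<close> of another one is in A_p. On each cube the infima \<open>r\<close> and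
  \<open>s\<close> of the two maximal functions bound the negative powers, and they cancel in the
  A_p product, so \<open>K\<close> can be fixed before \<open>f\<close> and
  \<open>h\<close>.\<close>

lemma maximal_Ap_weight:
  fixes p \<alpha> \<mu> :: real
  assumes "1 < p" "0 \<le> \<alpha>" "\<alpha> < p - 1" "0 < \<mu>" "\<mu> < 1"
  obtains K where "0 < K" and "\<And>(f :: real ^ 'n \<Rightarrow> real) h x0 x1.
    f \<in> borel_measurable lebesgue \<Longrightarrow> \<not> (AE x in lebesgue. f x = 0) \<Longrightarrow> maximal f x0 < \<infinity> \<Longrightarrow>
    h \<in> borel_measurable lebesgue \<Longrightarrow> \<not> (AE x in lebesgue. h x = 0) \<Longrightarrow> maximal h x1 < \<infinity> \<Longrightarrow>
    (\<lambda>x. enn2real (maximal f x) powr (- \<alpha>) * enn2real (maximal h x) powr \<mu>) \<in> Ap p \<and>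
    Ap_const p (\<lambda>x. enn2real (maximal f x) powr (- \<alpha>) * enn2real (maximal h x) powr \<mu>) \<le> ennreal K"
proof -
  \<comment> \<open>With this exponent, \<open>(Mf)\<close> to the power \<open>-\<alpha>\<close> is
    the power \<open>1 - p\<close> of \<open>(Mf)\<close> to the power \<open>\<gamma>\<close>, and
    \<open>\<gamma> < 1\<close> says that \<open>\<alpha> < p - 1\<close>.\<close>
  define \<gamma> where "\<gamma> = \<alpha> / (p - 1)"
  have \<gamma>: "0 \<le> \<gamma>" "\<gamma> < 1" "\<gamma> * (p - 1) = \<alpha>" using assms by (auto simp: \<gamma>_def)
  obtain C1 where C1: "0 < C1" "\<And>(f :: real ^ 'n \<Rightarrow> real) x0 a l. f \<in> borel_measurable lebesgue \<Longrightarrow>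
    \<not> (AE x in lebesgue. f x = 0) \<Longrightarrow> maximal f x0 < \<infinity> \<Longrightarrow> 0 < l \<Longrightarrow>
    \<exists>r>0. (\<forall>x\<in>cube a l. ennreal r \<le> maximal f x) \<and>
      (\<integral>\<^sup>+x\<in>cube a l. ennreal (enn2real (maximal f x) powr \<gamma>) \<partial>lebesgue)
        \<le> ennreal (C1 * r powr \<gamma> * l ^ CARD('n))"
    using maximal_powr_A1[OF \<gamma>(1,2)] by blast
  obtain C2 where C2: "0 < C2" "\<And>(f :: real ^ 'n \<Rightarrow> real) x0 a l. f \<in> borel_measurable lebesgue \<Longrightarrow>
    \<not> (AE x in lebesgue. f x = 0) \<Longrightarrow> maximal f x0 < \<infinity> \<Longrightarrow> 0 < l \<Longrightarrow>
    \<exists>r>0. (\<forall>x\<in>cube a l. ennreal r \<le> maximal f x) \<and>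
      (\<integral>\<^sup>+x\<in>cube a l. ennreal (enn2real (maximal f x) powr \<mu>) \<partial>lebesgue)
        \<le> ennreal (C2 * r powr \<mu> * l ^ CARD('n))"
    using maximal_powr_A1[OF less_imp_le[OF assms(4)] assms(5)] by blast
  define K where "K = C2 * C1 powr (p - 1)"
  have "(\<lambda>x. enn2real (maximal f x) powr (- \<alpha>) * enn2real (maximal h x) powr \<mu>) \<in> Ap p \<and>
    Ap_const p (\<lambda>x. enn2real (maximal f x) powr (- \<alpha>) * enn2real (maximal h x) powr \<mu>) \<le> ennreal K"
    if f: "f \<in> borel_measurable lebesgue" "\<not> (AE x in lebesgue. f x = 0)" "maximal f x0 < \<infinity>"
      and h: "h \<in> borel_measurable lebesgue" "\<not> (AE x in lebesgue. h x = 0)" "maximal h x1 < \<infinity>"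
    for f h :: "real ^ 'n \<Rightarrow> real" and x0 x1
  proof -
    let ?F = "\<lambda>x. enn2real (maximal f x)" and ?H = "\<lambda>x. enn2real (maximal h x)"
    define w where "w = (\<lambda>x. ?F x powr (- \<alpha>) * ?H x powr \<mu>)"
    have w_meas: "w \<in> borel_measurable lebesgue" unfolding w_def by measurable
    have avgs: "\<exists>r>0. \<exists>s>0. avg (cube a l) (\<lambda>x. ennreal (w x)) \<le> ennreal (r powr (- \<alpha>) * (C2 * s powr \<mu>)) \<and>
        avg (cube a l) (\<lambda>x. ennreal (w x powr (- 1 / (p - 1)))) \<le> ennreal (C1 * r powr \<gamma> * s powr (- \<mu> / (p - 1)))"
      if l: "0 < l" for a :: "real ^ 'n" and l
    proof -
      let ?Q = "cube a l"
      obtain r where r: "0 < r" "\<And>x. x \<in> ?Q \<Longrightarrow> ennreal r \<le> maximal f x"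
        "(\<integral>\<^sup>+x\<in>?Q. ennreal (?F x powr \<gamma>) \<partial>lebesgue) \<le> ennreal (C1 * r powr \<gamma> * l ^ CARD('n))"
        using C1(2)[OF f l] by blast
      obtain s where s: "0 < s" "\<And>x. x \<in> ?Q \<Longrightarrow> ennreal s \<le> maximal h x"
        "(\<integral>\<^sup>+x\<in>?Q. ennreal (?H x powr \<mu>) \<partial>lebesgue) \<le> ennreal (C2 * s powr \<mu> * l ^ CARD('n))"
        using C2(2)[OF h l] by blast
      \<comment> \<open>At points where a maximal function is infinite, \<open>enn2real\<close>
        gives 0. As 0 \<open>powr\<close> any exponent is 0, the bounds by negative powers of
        \<open>r\<close> and \<open>s\<close> hold there too.\<close>
      have F: "?F x = 0 \<or> r \<le> ?F x" if "x \<in> ?Q" for x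
        using r(2)[OF that] by (cases "maximal f x") auto
      have H: "?H x = 0 \<or> s \<le> ?H x" if "x \<in> ?Q" for x
        using s(2)[OF that] by (cases "maximal h x") auto
      have neg: "t powr (- b) \<le> u powr (- b)" if "t = 0 \<or> u \<le> t" "0 < u" "0 \<le> b" for t u b :: real
        using that by (auto intro: powr_mono2')
      have "(\<integral>\<^sup>+x\<in>?Q. ennreal (w x) \<partial>lebesgue)
          \<le> (\<integral>\<^sup>+x. ennreal (r powr (- \<alpha>)) * (ennreal (?H x powr \<mu>) * indicator ?Q x) \<partial>lebesgue)"
      proof (rule nn_integral_mono)
        fix x
        show "ennreal (w x) * indicator ?Q x \<le> ennreal (r powr (- \<alpha>)) * (ennreal (?H x powr \<mu>) * indicator ?Q x)"
        proof (cases "x \<in> ?Q")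
          case True
          have "w x \<le> r powr (- \<alpha>) * ?H x powr \<mu>"
            unfolding w_def using neg[OF F[OF True] r(1) assms(2)] by (rule mult_right_mono) simp
          then show ?thesis using True by (simp add: ennreal_mult'[symmetric] ennreal_leI)
        qed simp
      qed
      also have "\<dots> = ennreal (r powr (- \<alpha>)) * (\<integral>\<^sup>+x\<in>?Q. ennreal (?H x powr \<mu>) \<partial>lebesgue)"
        by (intro nn_integral_cmult) measurable
      also have "\<dots> \<le> ennreal (r powr (- \<alpha>)) * ennreal (C2 * s powr \<mu> * l ^ CARD('n))"
        by (intro mult_left_mono s(3)) simp
      also have "\<dots> = ennreal (r powr (- \<alpha>) * (C2 * s powr \<mu>)) * ennreal (l ^ CARD('n))"
        using C2(1) l by (simp add: ennreal_mult'[symmetric] mult.assoc)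
      finally have 1: "avg ?Q (\<lambda>x. ennreal (w x)) \<le> ennreal (r powr (- \<alpha>) * (C2 * s powr \<mu>))"
        using l by (simp add: avg_cube_iff)
      \<comment> \<open>In the dual weight the roles are exchanged: \<open>?F\<close> has the
        positive power, to be averaged, and \<open>?H\<close> the negative one, to be bounded by
        \<open>s\<close>.\<close>
      have weq: "w x powr (- 1 / (p - 1)) = ?F x powr \<gamma> * ?H x powr (- (\<mu> / (p - 1)))" for x
        using assms unfolding w_def by (simp add: powr_mult powr_powr \<gamma>_def)
      have "(\<integral>\<^sup>+x\<in>?Q. ennreal (w x powr (- 1 / (p - 1))) \<partial>lebesgue)
          \<le> (\<integral>\<^sup>+x. ennreal (s powr (- (\<mu> / (p - 1)))) * (ennreal (?F x powr \<gamma>) * indicator ?Q x) \<partial>lebesgue)"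
      proof (rule nn_integral_mono)
        fix x
        show "ennreal (w x powr (- 1 / (p - 1))) * indicator ?Q x
            \<le> ennreal (s powr (- (\<mu> / (p - 1)))) * (ennreal (?F x powr \<gamma>) * indicator ?Q x)"
        proof (cases "x \<in> ?Q")
          case True
          have "?H x powr (- (\<mu> / (p - 1))) \<le> s powr (- (\<mu> / (p - 1)))"
            using assms by (intro neg[OF H[OF True] s(1)]) simp
          then have "w x powr (- 1 / (p - 1)) \<le> s powr (- (\<mu> / (p - 1))) * ?F x powr \<gamma>"
            unfolding weq mult.commute[of "?F x powr \<gamma>"] by (rule mult_right_mono) simp
          then show ?thesis using True by (simp add: ennreal_mult'[symmetric] ennreal_leI)
        qed simp
      qed
      also have "\<dots> = ennreal (s powr (- (\<mu> / (p - 1)))) * (\<integral>\<^sup>+x\<in>?Q. ennreal (?F x powr \<gamma>) \<partial>lebesgue)"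
        by (intro nn_integral_cmult) measurable
      also have "\<dots> \<le> ennreal (s powr (- (\<mu> / (p - 1)))) * ennreal (C1 * r powr \<gamma> * l ^ CARD('n))"
        by (intro mult_left_mono r(3)) simp
      also have "\<dots> = ennreal (C1 * r powr \<gamma> * s powr (- \<mu> / (p - 1))) * ennreal (l ^ CARD('n))"
      proof -
        have "s powr (- (\<mu> / (p - 1))) * (C1 * r powr \<gamma> * l ^ CARD('n))
            = C1 * r powr \<gamma> * s powr (- \<mu> / (p - 1)) * l ^ CARD('n)"
          by simp
        then show ?thesis
          using C1(1) by (subst (1 2) ennreal_mult'[symmetric]) (simp_all add: mult_ac)
      qed
      finally have 2: "avg ?Q (\<lambda>x. ennreal (w x powr (- 1 / (p - 1)))) \<le> ennreal (C1 * r powr \<gamma> * s powr (- \<mu> / (p - 1)))"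
        using l by (simp add: avg_cube_iff)
      show ?thesis using 1 2 r(1) s(1) by blast
    qed
    have const: "Ap_const p w \<le> ennreal K"
      unfolding Ap_const_def
    proof (rule SUP_least)
      fix Q :: "(real ^ 'n) set" assume "Q \<in> cubes"
      then obtain a l where Q: "Q = cube a l" "0 < l" by (auto simp: cubes_eq)
      obtain r s where rs: "0 < r" "0 < s" "avg Q (\<lambda>x. ennreal (w x)) \<le> ennreal (r powr (- \<alpha>) * (C2 * s powr \<mu>))"
        "avg Q (\<lambda>x. ennreal (w x powr (- 1 / (p - 1)))) \<le> ennreal (C1 * r powr \<gamma> * s powr (- \<mu> / (p - 1)))"
        using avgs[OF Q(2), of a] unfolding Q(1) by blast
      let ?c = "C1 * r powr \<gamma> * s powr (- \<mu> / (p - 1))"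
      have "avg Q (\<lambda>x. ennreal (w x)) * epowr (avg Q (\<lambda>x. ennreal (w x powr (- 1 / (p - 1))))) (p - 1)
          \<le> ennreal (r powr (- \<alpha>) * (C2 * s powr \<mu>)) * epowr (ennreal ?c) (p - 1)"
        using rs assms by (intro mult_mono epowr_mono) auto
      also have "\<dots> = ennreal (r powr (- \<alpha>) * (C2 * s powr \<mu>) * ?c powr (p - 1))"
        using C1(1) C2(1) by (subst epowr_ennreal) (simp_all add: ennreal_mult'[symmetric])
      also have "?c powr (p - 1) = C1 powr (p - 1) * r powr \<alpha> * s powr (- \<mu>)"
        using C1(1) assms(1) by (simp add: powr_mult powr_powr \<gamma>(3))
      also have "r powr (- \<alpha>) * (C2 * s powr \<mu>) * (C1 powr (p - 1) * r powr \<alpha> * s powr (- \<mu>)) = K"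
      proof -
        have "r powr (- \<alpha>) * r powr \<alpha> = 1" "s powr \<mu> * s powr (- \<mu>) = 1"
          using rs(1,2) by (simp_all add: powr_add[symmetric])
        then have "(r powr (- \<alpha>) * r powr \<alpha>) * (s powr \<mu> * s powr (- \<mu>)) * (C2 * C1 powr (p - 1)) = K"
          by (simp add: K_def)
        then show ?thesis by (simp only: mult_ac)
      qed
      finally show "avg Q (\<lambda>x. ennreal (w x)) * epowr (avg Q (\<lambda>x. ennreal (w x powr (- 1 / (p - 1))))) (p - 1) \<le> ennreal K" .
    qed
    have "weight w"
      unfolding weight_def locally_integrable_def
    proof (intro conjI allI impI)
      show "w \<in> borel_measurable lebesgue" by (rule w_meas)
      show "0 \<le> w x" for x by (simp add: w_def)
      show "set_integrable lebesgue T w" if "compact T" for T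
      proof -
        obtain a l where al: "0 < l" "T \<subseteq> cube a l" using compact_subset_cube[OF \<open>compact T\<close>] .
        have T: "T \<in> sets lebesgue" using \<open>compact T\<close> by (simp add: borel_compact)
        obtain c where c: "avg (cube a l) (\<lambda>x. ennreal (w x)) \<le> ennreal c"
          using avgs[OF al(1), of a] by blast
        have "(\<integral>\<^sup>+x. ennreal (norm (indicator T x *\<^sub>R w x)) \<partial>lebesgue) \<le> (\<integral>\<^sup>+x\<in>cube a l. ennreal (w x) \<partial>lebesgue)"
          using al(2) by (intro nn_integral_mono) (auto simp: w_def split: split_indicator)
        also have "\<dots> \<le> ennreal c * ennreal (l ^ CARD('n))"
          using c al(1) by (simp add: avg_cube_iff)
        also have "\<dots> < \<infinity>" by (simp add: ennreal_mult_less_top)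
        finally show ?thesis
          unfolding set_integrable_def using T w_meas by (intro integrableI_bounded) auto
      qed
      \<comment> \<open>Finiteness is essential here: at an infinite value \<open>enn2real\<close>
        would make \<open>w\<close> vanish.\<close>
      show "AE x in lebesgue. 0 < w x"
        using AE_maximal_finite[OF f(1,3)] AE_maximal_finite[OF h(1,3)]
      proof eventually_elim
        case (elim x)
        then have "0 < ?F x" "0 < ?H x"
          using maximal_pos[OF f(1,2), of x] maximal_pos[OF h(1,2), of x] by (auto simp: enn2real_positive_iff)
        then show ?case by (simp add: w_def)
      qed
    qed
    moreover have "Ap_const p w < \<infinity>" using const by (rule le_less_trans) simp
    ultimately show ?thesis using const by (simp add: Ap_def w_def)
  qed
  moreover have "0 < K" using C1 C2 by (simp add: K_def)
  ultimately show ?thesis using that by blast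
qed

section \<open>From the weighted weak type hypothesis to the distributional estimate\<close>

text \<open>This is the a.e. domination of \<open>\<bar>v\<bar> powr (1 / \<mu>)\<close> by its
  maximal function, raised to the power \<open>\<mu>\<close>. Finiteness a.e. makes the real-valued
  form meaningful.\<close>

lemma AE_maximal_mu_ge:
  fixes v :: "real ^ 'n \<Rightarrow> real"
  assumes v: "v \<in> borel_measurable lebesgue" and \<mu>: "0 < \<mu>"
    and fin: "AE x in lebesgue. maximal (\<lambda>t. \<bar>v t\<bar> powr (1 / \<mu>)) x < \<infinity>"
  shows "AE x in lebesgue. \<bar>v x\<bar> \<le> enn2real (maximal (\<lambda>t. \<bar>v t\<bar> powr (1 / \<mu>)) x) powr \<mu>"
proof -
  let ?h = "\<lambda>t. \<bar>v t\<bar> powr (1 / \<mu>)"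
  have "?h \<in> borel_measurable lebesgue" using v by measurable
  from AE_abs_le_maximal[OF this] fin show ?thesis
  proof eventually_elim
    case (elim x)
    then have "?h x \<le> enn2real (maximal ?h x)"
      using enn2real_mono[of "ennreal (?h x)" "maximal ?h x"] by simp
    then have "?h x powr \<mu> \<le> enn2real (maximal ?h x) powr \<mu>"
      using \<mu> by (intro powr_mono2) auto
    then show ?case using \<mu> by (simp add: powr_powr)
  qed
qed

text \<open>As \<open>w\<close> is positive a.e., a level set of zero \<open>w\<close>-measure is
  Lebesgue null, hence null for any density \<open>u\<close>.\<close>

lemma dist_fn_eq_0_transfer:
  assumes w: "weight w" and g: "g \<in> borel_measurable lebesgue" and u: "u \<in> borel_measurable lebesgue"
    and z: "dist_fn w (\<lambda>x. ennreal \<bar>g x\<bar>) y = 0"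
  shows "dist_fn u (\<lambda>x. ennreal \<bar>g x\<bar>) y = 0"
proof -
  have A: "{x. ennreal y < ennreal \<bar>g x\<bar>} \<in> sets lebesgue"
  proof -
    have "{x \<in> space lebesgue. ennreal y < ennreal \<bar>g x\<bar>} \<in> sets lebesgue"
      using g by measurable
    then show ?thesis by simp
  qed
  have wm: "w \<in> borel_measurable lebesgue" "AE x in lebesgue. 0 < w x"
    using w by (auto simp: weight_def locally_integrable_def)
  have "AE x in lebesgue. ennreal (w x) * indicator {x. ennreal y < ennreal \<bar>g x\<bar>} x = 0"
    using z wm A unfolding dist_fn_def by (subst (asm) nn_integral_0_iff_AE) auto
  then have "AE x in lebesgue. ennreal (u x) * indicator {x. ennreal y < ennreal \<bar>g x\<bar>} x = 0"
    using wm(2) by eventually_elim (auto simp: indicator_def split: if_splits)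
  then show ?thesis
    using u A unfolding dist_fn_def by (subst nn_integral_0_iff_AE) auto
qed

theorem theorem2p1:
  fixes p0 \<alpha> \<mu> :: real and \<phi> :: "real \<Rightarrow> real"
  assumes "1 < p0" and "locally_bounded \<phi>"
    and "0 \<le> \<alpha>" and "\<alpha> < p0 - 1" and "0 < \<mu>" and "\<mu> < 1"
  shows "\<exists>C>0. \<forall>(f :: real ^ 'n \<Rightarrow> real) g.
    f \<in> borel_measurable lebesgue \<longrightarrow> (\<forall>x. 0 \<le> f x) \<longrightarrow>
    g \<in> borel_measurable lebesgue \<longrightarrow> (\<forall>x. 0 \<le> g x) \<longrightarrow>
    (\<forall>w\<in>Ap p0. weak_Lp_norm p0 w g
        \<le> ennreal (\<phi> (enn2real (Ap_const p0 w))) * Lp_norm p0 w f) \<longrightarrow>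
    (\<forall>u y. locally_integrable u \<longrightarrow> (\<forall>x. 0 \<le> u x) \<longrightarrow> 0 < y \<longrightarrow>
      dist_fn u (\<lambda>x. ennreal \<bar>g x\<bar>) y
        \<le> ennreal C * (dist_fn u (maximal f) y
            + ennreal (1 / y powr (p0 - \<alpha>))
              * (\<integral>\<^sup>+x. ennreal (f x powr (p0 - \<alpha>))
                   * maximal_mu \<mu> (\<lambda>t. u t * indicator {t. y < g t} t) x \<partial>lebesgue)))"
proof -
  obtain K where K: "0 < K" "\<And>(f :: real ^ 'n \<Rightarrow> real) h x0 x1.
    f \<in> borel_measurable lebesgue \<Longrightarrow> \<not> (AE x in lebesgue. f x = 0) \<Longrightarrow> maximal f x0 < \<infinity> \<Longrightarrow>
    h \<in> borel_measurable lebesgue \<Longrightarrow> \<not> (AE x in lebesgue. h x = 0) \<Longrightarrow> maximal h x1 < \<infinity> \<Longrightarrow>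
    (\<lambda>x. enn2real (maximal f x) powr (- \<alpha>) * enn2real (maximal h x) powr \<mu>) \<in> Ap p0 \<and>
    Ap_const p0 (\<lambda>x. enn2real (maximal f x) powr (- \<alpha>) * enn2real (maximal h x) powr \<mu>) \<le> ennreal K"
    using maximal_Ap_weight[OF assms(1,3,4,5,6)] by blast
  \<comment> \<open>The A_p constants in question may equal \<open>K\<close>; the open interval is
    taken up to \<open>K + 1\<close> to include that value.\<close>
  have "bdd_above (\<phi> ` {0<..<K + 1})"
    using assms(2) K(1) by (simp add: locally_bounded_def)
  then obtain B0 where "\<forall>x\<in>\<phi> ` {0<..<K + 1}. x \<le> B0"
    unfolding bdd_above_def by blast
  then have B0: "\<phi> t \<le> B0" if "0 < t" "t < K + 1" for t
    using that by simp
  define B where "B = max B0 1"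
  have B: "0 < B" by (simp add: B_def)
  have \<phi>B: "\<phi> (enn2real (Ap_const p0 w)) \<le> B" if "w \<in> Ap p0" "Ap_const p0 w \<le> ennreal K"
    for w :: "real ^ 'n \<Rightarrow> real"
  proof -
    have "0 < Ap_const p0 w" "Ap_const p0 w < \<infinity>" using that(1) Ap_const_pos by (auto simp: Ap_def)
    then have "0 < enn2real (Ap_const p0 w)" by (simp add: enn2real_positive_iff)
    moreover have "enn2real (Ap_const p0 w) \<le> K"
      using enn2real_mono[OF that(2)] K(1) by simp
    ultimately show ?thesis using B0[of "enn2real (Ap_const p0 w)"] by (simp add: B_def)
  qed
  \<comment> \<open>\<open>B powr p0\<close> serves the integral term, and the summand 1 makes
    \<open>C\<close> large enough for the term with \<open>maximal f\<close>.\<close>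
  define C where "C = B powr p0 + 1"
  have C: "0 < C" "1 \<le> C" "B powr p0 \<le> C" by (auto simp: C_def intro: add_nonneg_pos)
  have "dist_fn u (\<lambda>x. ennreal \<bar>g x\<bar>) y
        \<le> ennreal C * (dist_fn u (maximal f) y
            + ennreal (1 / y powr (p0 - \<alpha>))
              * (\<integral>\<^sup>+x. ennreal (f x powr (p0 - \<alpha>))
                   * maximal_mu \<mu> (\<lambda>t. u t * indicator {t. y < g t} t) x \<partial>lebesgue))"
    (is "?L \<le> ennreal C * (?R + ennreal ?c * ?J)")
    if f: "f \<in> borel_measurable lebesgue" "\<And>x. 0 \<le> f x"
      and g: "g \<in> borel_measurable lebesgue" "\<And>x. 0 \<le> g x"
      and hyp: "\<And>w. w \<in> Ap p0 \<Longrightarrow> weak_Lp_norm p0 w g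
        \<le> ennreal (\<phi> (enn2real (Ap_const p0 w))) * Lp_norm p0 w f"
      and u: "locally_integrable u" "\<And>x. 0 \<le> u x" and y: "0 < y"
    for f g u :: "real ^ 'n \<Rightarrow> real" and y
  proof -
    have um: "u \<in> borel_measurable lebesgue" using u(1) by (simp add: locally_integrable_def)
    let ?A = "{t. y < g t}"
    have Aeq: "{x. ennreal y < ennreal \<bar>g x\<bar>} = ?A" using y g(2) by (auto simp: ennreal_less_iff)
    have A: "?A \<in> sets lebesgue"
    proof -
      have "{t \<in> space lebesgue. y < g t} \<in> sets lebesgue" using g(1) by measurable
      then show ?thesis by simp
    qed
    let ?v = "\<lambda>t. u t * indicator ?A t"
    let ?h = "\<lambda>t. \<bar>?v t\<bar> powr (1 / \<mu>)"
    have vm: "?v \<in> borel_measurable lebesgue" using um A by measurable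
    then have hm: "?h \<in> borel_measurable lebesgue" by measurable
    have c: "0 < ?c" using y by simp
    have level: "ennreal (y powr p0) * dist_fn w (\<lambda>x. ennreal \<bar>g x\<bar>) y
        \<le> ennreal (B powr p0) * (\<integral>\<^sup>+x. ennreal (\<bar>f x\<bar> powr p0 * w x) \<partial>lebesgue)"
      if w: "w \<in> Ap p0" "Ap_const p0 w \<le> ennreal K" for w
    proof (rule weak_type_level_bound)
      have "weak_Lp_norm p0 w g \<le> ennreal (\<phi> (enn2real (Ap_const p0 w))) * Lp_norm p0 w f"
        using w(1) by (rule hyp)
      also have "\<dots> \<le> ennreal B * Lp_norm p0 w f"
        by (intro mult_right_mono ennreal_leI \<phi>B w) simp
      finally show "weak_Lp_norm p0 w g \<le> ennreal B * Lp_norm p0 w f" .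
    qed (use assms(1) B y in auto)
    have dich: "(\<forall>x. maximal k x = \<infinity>) \<or> (\<exists>x. maximal k x < \<infinity>)" for k :: "real ^ 'n \<Rightarrow> real"
      by (auto simp: less_top)
    \<comment> \<open>The last case provides the hypotheses of \<open>maximal_Ap_weight\<close>; the
      first four are the ways in which they can fail.\<close>
    consider "AE x in lebesgue. f x = 0" | "\<And>x. maximal f x = \<infinity>" | "AE x in lebesgue. ?h x = 0"
      | "\<not> (AE x in lebesgue. f x = 0)" "\<And>x. maximal ?h x = \<infinity>"
      | x0 x1 where "\<not> (AE x in lebesgue. f x = 0)" "maximal f x0 < \<infinity>"
          "\<not> (AE x in lebesgue. ?h x = 0)" "maximal ?h x1 < \<infinity>"
      using dich[of f] dich[of ?h] by blast
    then show ?thesis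
    proof cases
      case 1
      \<comment> \<open>Both terms on the right vanish when \<open>f\<close> is null, so
        \<open>?L\<close> has to be 0. Any single weight within the bound \<open>K\<close> shows
        this; the maximal function of 1 supplies one.\<close>
      define w :: "real ^ 'n \<Rightarrow> real" where
        "w = (\<lambda>x. enn2real (maximal (\<lambda>_. 1) x) powr (- \<alpha>) * enn2real (maximal (\<lambda>_. 1) x) powr \<mu>)"
      have nz: "\<not> (AE x in (lebesgue :: (real ^ 'n) measure). (1::real) = 0)"
      proof
        assume "AE x in (lebesgue :: (real ^ 'n) measure). (1::real) = 0"
        then have "AE x in lebesgue. x \<notin> cube (0 :: real ^ 'n) 1"
          by (rule eventually_mono) simp
        then show False by (rule cube_not_AE[OF zero_less_one])
      qed
      have w: "w \<in> Ap p0" "Ap_const p0 w \<le> ennreal K"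
        unfolding w_def
        using K(2)[OF borel_measurable_const nz maximal_one borel_measurable_const nz maximal_one] by blast+
      have "(\<integral>\<^sup>+x. ennreal (\<bar>f x\<bar> powr p0 * w x) \<partial>lebesgue) = nn_integral lebesgue (\<lambda>x :: real ^ 'n. 0)"
      proof (rule nn_integral_cong_AE)
        show "AE x in lebesgue. ennreal (\<bar>f x\<bar> powr p0 * w x) = 0"
          using 1 by eventually_elim simp
      qed
      then have "ennreal (y powr p0) * dist_fn w (\<lambda>x. ennreal \<bar>g x\<bar>) y \<le> ennreal (B powr p0) * 0"
        using level[OF w] by (simp only: nn_integral_const mult_zero_left)
      then have D0: "dist_fn w (\<lambda>x. ennreal \<bar>g x\<bar>) y = 0" using y by simp
      have "weight w" using w(1) by (simp add: Ap_def)
      then have "?L = 0" using g(1) um D0 by (rule dist_fn_eq_0_transfer)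
      then show ?thesis by simp
    next
      case 2
      have "?L \<le> ?R" unfolding dist_fn_def 2
        by (intro nn_integral_mono) (auto split: split_indicator)
      also have "\<dots> \<le> 1 * (?R + ennreal ?c * ?J)" by simp
      also have "\<dots> \<le> ennreal C * (?R + ennreal ?c * ?J)"
        using C(2) by (intro mult_right_mono) auto
      finally show ?thesis .
    next
      case 3
      then have "AE x in lebesgue. ennreal (u x) * indicator ?A x = 0"
        by eventually_elim (auto simp: indicator_def split: if_splits)
      then have "?L = 0"
        unfolding dist_fn_def Aeq using um A by (subst nn_integral_0_iff_AE) auto
      then show ?thesis by simp
    next
      case 4
      \<comment> \<open>A nonzero integral of the power of \<open>f\<close> rules out the product of
        zero and infinity, so \<open>?J\<close> is infinite.\<close>
      have "(\<integral>\<^sup>+x. ennreal (f x powr (p0 - \<alpha>)) \<partial>lebesgue) \<noteq> 0"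
      proof
        assume "(\<integral>\<^sup>+x. ennreal (f x powr (p0 - \<alpha>)) \<partial>lebesgue) = 0"
        then have "AE x in lebesgue. ennreal (f x powr (p0 - \<alpha>)) = 0"
          using f(1) by (subst (asm) nn_integral_0_iff_AE) auto
        then have "AE x in lebesgue. f x = 0" by eventually_elim auto
        then show False using 4(1) by simp
      qed
      moreover have "?J = (\<integral>\<^sup>+x. ennreal (f x powr (p0 - \<alpha>)) \<partial>lebesgue) * top"
        unfolding maximal_mu_def 4(2) epowr_def using f(1) by (simp add: nn_integral_multc)
      ultimately have "?J = top" by (simp add: ennreal_mult_top)
      then show ?thesis using C(1) c by (simp add: ennreal_mult_top)
    next
      case 5
      let ?F = "\<lambda>x. enn2real (maximal f x)" and ?H = "\<lambda>x. enn2real (maximal ?h x)"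
      define w where "w = (\<lambda>x. ?F x powr (- \<alpha>) * ?H x powr \<mu>)"
      have w: "w \<in> Ap p0" "Ap_const p0 w \<le> ennreal K"
        unfolding w_def using K(2)[OF f(1) 5(1,2) hm 5(3,4)] by auto
      have wm: "w \<in> borel_measurable lebesgue" unfolding w_def by measurable
      have finF: "AE x in lebesgue. maximal f x < \<infinity>" by (rule AE_maximal_finite[OF f(1) 5(2)])
      have finH: "AE x in lebesgue. maximal ?h x < \<infinity>" by (rule AE_maximal_finite[OF hm 5(4)])
      let ?D = "dist_fn w (\<lambda>x. ennreal \<bar>g x\<bar>) y"
      \<comment> \<open>The set \<open>?A\<close> is split at \<open>maximal f x > y\<close>. That
        part goes to \<open>?R\<close>; on the rest \<open>u\<close> is dominated a.e. by
        \<open>y powr \<alpha> * w\<close>.\<close>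
      have "?L \<le> (\<integral>\<^sup>+x. ennreal (u x) * indicator {x. ennreal y < maximal f x} x
          + ennreal (y powr \<alpha>) * (ennreal (w x) * indicator ?A x) \<partial>lebesgue)"
        unfolding dist_fn_def Aeq
      proof (rule nn_integral_mono_AE)
        show "AE x in lebesgue. ennreal (u x) * indicator ?A x
          \<le> ennreal (u x) * indicator {x. ennreal y < maximal f x} x
            + ennreal (y powr \<alpha>) * (ennreal (w x) * indicator ?A x)"
          using AE_maximal_mu_ge[OF vm assms(5) finH] finF
        proof eventually_elim
          case (elim x)
          show ?case
          proof (cases "x \<in> ?A \<and> \<not> ennreal y < maximal f x")
            case True
            then have "?F x \<le> y" using y enn2real_mono[of "maximal f x" "ennreal y"] by (simp add: not_less)
            moreover have "0 < ?F x" using maximal_pos[OF f(1) 5(1), of x] elim(2) by (simp add: enn2real_positive_iff)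
            \<comment> \<open>The negative exponent reverses \<open>?F x \<le> y\<close>; strict
              positivity of \<open>?F x\<close> keeps \<open>powr\<close> away from its value at
              0.\<close>
            ultimately have "y powr (- \<alpha>) \<le> ?F x powr (- \<alpha>)"
              using assms(3) by (intro powr_mono2') auto
            moreover have "u x \<le> ?H x powr \<mu>" using elim(1) True u(2)[of x] by simp
            ultimately have "y powr (- \<alpha>) * u x \<le> w x"
              unfolding w_def using u(2)[of x] by (intro mult_mono) auto
            then have "y powr \<alpha> * (y powr (- \<alpha>) * u x) \<le> y powr \<alpha> * w x"
              by (rule mult_left_mono) simp
            also have "y powr \<alpha> * (y powr (- \<alpha>) * u x) = u x"
              using y by (simp add: powr_minus)
            finally have "ennreal (u x) \<le> ennreal (y powr \<alpha>) * ennreal (w x)"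
              by (simp add: ennreal_mult'[symmetric] ennreal_leI)
            then show ?thesis using True by simp
          next
            case False
            then show ?thesis by (auto split: split_indicator)
          qed
        qed
      qed
      also have "\<dots> = ?R + ennreal (y powr \<alpha>) * ?D"
      proof -
        have "{x. ennreal y < maximal f x} \<in> sets lebesgue"
          using open_maximal_greater[of "ennreal y" f] by (simp add: borel_open)
        then show ?thesis
          unfolding dist_fn_def Aeq using um wm A by (simp add: nn_integral_add nn_integral_cmult)
      qed
      also have "ennreal (y powr \<alpha>) * ?D \<le> ennreal C * (ennreal ?c * ?J)"
      proof -
        have "(\<integral>\<^sup>+x. ennreal (\<bar>f x\<bar> powr p0 * w x) \<partial>lebesgue) \<le> ?J"
        proof (rule nn_integral_mono_AE)
          show "AE x in lebesgue. ennreal (\<bar>f x\<bar> powr p0 * w x)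
            \<le> ennreal (f x powr (p0 - \<alpha>)) * maximal_mu \<mu> ?v x"
            using AE_abs_le_maximal[OF f(1)] finF
          proof eventually_elim
            case (elim x)
            have "f x \<le> ?F x"
              using enn2real_mono[OF elim(1)] elim(2) f(2)[of x] by simp
            \<comment> \<open>Replacing \<open>?F x\<close> by the smaller \<open>f x\<close>
              increases the negative power. The case \<open>f x = 0\<close> is separate, since there
              \<open>powr\<close> does not follow that monotonicity.\<close>
            have "f x powr p0 * ?F x powr (- \<alpha>) \<le> f x powr (p0 - \<alpha>)"
            proof (cases "f x = 0")
              case False
              then have "0 < f x" using f(2)[of x] by simp
              then have "f x powr p0 * ?F x powr (- \<alpha>) \<le> f x powr p0 * f x powr (- \<alpha>)"
                using \<open>f x \<le> ?F x\<close> assms(3) by (intro mult_left_mono powr_mono2') auto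
              then show ?thesis by (simp add: powr_add[symmetric])
            qed simp
            then have "f x powr p0 * ?F x powr (- \<alpha>) * ?H x powr \<mu> \<le> f x powr (p0 - \<alpha>) * ?H x powr \<mu>"
              by (rule mult_right_mono) simp
            then have "ennreal (\<bar>f x\<bar> powr p0 * w x) \<le> ennreal (f x powr (p0 - \<alpha>)) * ennreal (?H x powr \<mu>)"
              using f(2)[of x] by (simp add: w_def mult.assoc ennreal_mult'[symmetric] ennreal_leI)
            also have "\<dots> \<le> ennreal (f x powr (p0 - \<alpha>)) * maximal_mu \<mu> ?v x"
              unfolding maximal_mu_def by (intro mult_left_mono ennreal_enn2real_powr_le_epowr) simp
            finally show ?case .
          qed
        qed
        then have le: "ennreal (y powr p0) * ?D \<le> ennreal C * ?J"
          using C(3) by (intro order_trans[OF level[OF w] mult_mono]) (auto intro: ennreal_leI)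
        \<comment> \<open>The weak type bound carries \<open>y powr p0\<close>; dividing by
          \<open>y powr (p0 - \<alpha>)\<close> leaves exactly the factor
          \<open>y powr \<alpha>\<close> in front of \<open>?D\<close>.\<close>
        have "y powr \<alpha> = ?c * y powr p0"
          using y by (simp add: powr_diff)
        then have "ennreal (y powr \<alpha>) * ?D = ennreal ?c * (ennreal (y powr p0) * ?D)"
          using c by (simp only: ennreal_mult' mult.assoc less_imp_le)
        also have "\<dots> \<le> ennreal ?c * (ennreal C * ?J)" using le by (rule mult_left_mono) simp
        finally show ?thesis by (simp add: mult.left_commute)
      qed
      finally have "?L \<le> ?R + ennreal C * (ennreal ?c * ?J)" by (simp add: add_left_mono)
      also have "\<dots> \<le> ennreal C * ?R + ennreal C * (ennreal ?c * ?J)"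
        using C(2) mult_right_mono[of 1 "ennreal C" ?R] by (intro add_right_mono) simp
      finally show ?thesis by (simp add: distrib_left)
    qed
  qed
  then show ?thesis
    using C(1) by (intro exI[of _ C] conjI allI impI) simp_all
qed

end
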